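(* Let $m$ and $d$ be positive integers, and let $U_{m,d}$ be the uniform matroid of rank $d$ on a set of $m+d$ elements. Write its Kazhdan–Lusztig polynomial as $P_{U_{m,d}}(t)=\sum_{i=0}^{\lfloor (d-1)/2\rfloor} c_{m,d}^i t^i$. Then for every $0\le i\le \lfloor (d-1)/2\rfloor$, \[ c_{m,d}^i=\binom{d+m}{i}\sum_{h=1}^{m}\frac{(-1)^{h+1}h}{d-h-i+m}\binom{d-h-i+m}{d-2i-h}\binom{m+i}{m-h}. \]
   Context: Binomial coefficients $\binom{n}{k}$ with $k<0$ are $0$. For a loopless matroid $M$ with lattice of flats $L(M)$, characteristic polynomial $\chi_M(t)$ and rank $\operatorname{rk} M$, the Kazhdan–Lusztig polynomial $P_M(t)\in\mathbb{Z}[t]$ (Elias–Proudfoot–Wakefield) is the unique assignment such that: $P_M(t)=1$ if $\operatorname{rk}M=0$; $\deg P_M(t)<\frac12\operatorname{rk}M$ if $\operatorname{rk}M>0$; and $t^{\operatorname{rk}M}P_M(t^{-1})=\sum_{F\in L(M)}\chi_{M_F}(t)P_{M^F}(t)$, where $M_F$ is the restriction (localization) of $M$ to the flat $F$ and $M^F$ is the contraction of $M$ by $F$. *)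

theory Defs
  imports Complex_Main "HOL-Computational_Algebra.Polynomial"
begin

datatype 'a matroid = Matroid (ground: "'a set") (indeps: "'a set set")

definition is_matroid :: "'a matroid \<Rightarrow> bool" where
  "is_matroid M \<longleftrightarrow>
     finite (ground M) \<and> indeps M \<subseteq> Pow (ground M) \<and> {} \<in> indeps M \<and>
     (\<forall>I\<in>indeps M. \<forall>J. J \<subseteq> I \<longrightarrow> J \<in> indeps M) \<and>
     (\<forall>I\<in>indeps M. \<forall>J\<in>indeps M. card I < card J \<longrightarrow> (\<exists>x\<in>J - I. insert x I \<in> indeps M))"

definition loopless :: "'a matroid \<Rightarrow> bool" where
  "loopless M \<longleftrightarrow> (\<forall>x\<in>ground M. {x} \<in> indeps M)"

definition mrank :: "'a matroid \<Rightarrow> 'a set \<Rightarrow> nat" where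
  "mrank M A = Max (card ` {I \<in> indeps M. I \<subseteq> A})"

abbreviation rk :: "'a matroid \<Rightarrow> nat" where
  "rk M \<equiv> mrank M (ground M)"

definition flats :: "'a matroid \<Rightarrow> 'a set set" where
  "flats M = {F. F \<subseteq> ground M \<and> (\<forall>x\<in>ground M - F. mrank M F < mrank M (insert x F))}"

definition restriction :: "'a matroid \<Rightarrow> 'a set \<Rightarrow> 'a matroid" where
  "restriction M F = Matroid F {I \<in> indeps M. I \<subseteq> F}"

definition contraction :: "'a matroid \<Rightarrow> 'a set \<Rightarrow> 'a matroid" where
  "contraction M F = Matroid (ground M - F)
     {I. I \<subseteq> ground M - F \<and> mrank M (I \<union> F) = card I + mrank M F}"

definition uniform_matroid :: "'a set \<Rightarrow> nat \<Rightarrow> 'a matroid" where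
  "uniform_matroid E d = Matroid E {I. I \<subseteq> E \<and> card I \<le> d}"

text \<open>The Moebius function of a family \<open>L\<close> of finite sets ordered by inclusion.\<close>

function mobius :: "'a set set \<Rightarrow> 'a set \<Rightarrow> 'a set \<Rightarrow> int" where
  "mobius L F G =
     (if F = G then 1
      else if F \<subset> G \<and> finite G then - (\<Sum>H\<in>{H\<in>L. F \<subseteq> H \<and> H \<subset> G}. mobius L F H)
      else 0)"
  by auto
termination
  by (relation "measure (\<lambda>(L, F, G). card G)") (auto intro: psubset_card_mono)

declare mobius.simps [simp del]

text \<open>For a loopless matroid the least flat is \<open>{}\<close>.\<close>

definition characteristic_poly :: "'a matroid \<Rightarrow> int poly" where
  "characteristic_poly M = (\<Sum>F\<in>flats M. monom (mobius (flats M) {} F) (rk M - mrank M F))"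

text \<open>For \<open>degree p \<le> n\<close>, the polynomial \<open>rev_poly n p\<close> is $t^n p(t^{-1})$.\<close>

definition rev_poly :: "nat \<Rightarrow> int poly \<Rightarrow> int poly" where
  "rev_poly n p = (\<Sum>i\<le>n. monom (coeff p i) (n - i))"

definition kl_assignment :: "('a matroid \<Rightarrow> int poly) \<Rightarrow> bool" where
  "kl_assignment P \<longleftrightarrow>
     (\<forall>M. is_matroid M \<and> loopless M \<longrightarrow>
        (rk M = 0 \<longrightarrow> P M = 1) \<and>
        (rk M > 0 \<longrightarrow> 2 * degree (P M) < rk M) \<and>
        rev_poly (rk M) (P M) =
          (\<Sum>F\<in>flats M. characteristic_poly (restriction M F) * P (contraction M F)))"

text \<open>An assignment is unconstrained outside the loopless matroids, so uniqueness is a statement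
  about its value at each loopless \<open>M\<close>; existence and uniqueness are proved at the end of
  this theory.\<close>

definition kl_poly :: "'a matroid \<Rightarrow> int poly" where
  "kl_poly M = (THE p. \<exists>P. kl_assignment P \<and> p = P M)"

definition int_binomial :: "int \<Rightarrow> int \<Rightarrow> real" where
  "int_binomial n k = (if k < 0 then 0 else of_int n gchoose nat k)"

lemma finite_indeps: "is_matroid M \<Longrightarrow> finite (indeps M)"
  unfolding is_matroid_def by (meson finite_Pow_iff finite_subset)

lemma finite_indep: "is_matroid M \<Longrightarrow> I \<in> indeps M \<Longrightarrow> finite I"
  unfolding is_matroid_def by (meson PowD finite_subset subsetD)

lemma card_le_mrank:
  assumes "is_matroid M" "I \<in> indeps M" "I \<subseteq> A"
  shows "card I \<le> mrank M A"
  unfolding mrank_def using assms finite_indeps[OF assms(1)] by (intro Max_ge) auto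

lemma mrank_witness:
  assumes "is_matroid M"
  obtains I where "I \<in> indeps M" "I \<subseteq> A" "card I = mrank M A"
proof -
  have "mrank M A \<in> card ` {I \<in> indeps M. I \<subseteq> A}"
    unfolding mrank_def
  proof (rule Max_in)
    show "finite (card ` {I \<in> indeps M. I \<subseteq> A})" using finite_indeps[OF assms] by auto
    have "{} \<in> indeps M" using assms by (simp add: is_matroid_def)
    then show "card ` {I \<in> indeps M. I \<subseteq> A} \<noteq> {}" by auto
  qed
  then show ?thesis using that by auto
qed

lemma extend_indep:
  assumes M: "is_matroid M" and I: "I \<in> indeps M" "I \<subseteq> A"
  obtains J where "J \<in> indeps M" "I \<subseteq> J" "J \<subseteq> A" "card J = mrank M A"
proof -
  let ?S = "{J \<in> indeps M. I \<subseteq> J \<and> J \<subseteq> A}"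
  have fin: "finite ?S" and ne: "?S \<noteq> {}" using finite_indeps[OF M] I by auto
  obtain J where J: "J \<in> ?S" and max: "\<And>K. K \<in> ?S \<Longrightarrow> card K \<le> card J"
    using Max_in[of "card ` ?S"] Max_ge[of "card ` ?S"] fin ne
    by (smt (verit, best) empty_is_image finite_imageI image_iff)
  have "card J = mrank M A"
  proof (rule ccontr)
    assume "card J \<noteq> mrank M A"
    then have lt: "card J < mrank M A" using card_le_mrank[OF M, of J A] J by auto
    obtain K where K: "K \<in> indeps M" "K \<subseteq> A" "card K = mrank M A"
      using mrank_witness[OF M] .
    obtain x where x: "x \<in> K - J" "insert x J \<in> indeps M"
      using M J K lt unfolding is_matroid_def by (metis (lifting) mem_Collect_eq)
    then have "insert x J \<in> ?S" using J K by auto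
    from max[OF this] show False using x finite_indep[OF M] J by auto
  qed
  with J that show ?thesis by auto
qed

lemma mrank_mono:
  assumes "is_matroid M" "A \<subseteq> B" shows "mrank M A \<le> mrank M B"
  using mrank_witness[OF assms(1)] card_le_mrank[OF assms(1)] assms(2)
  by (metis order_trans)

lemma mrank_le_card:
  assumes "is_matroid M" "finite A" shows "mrank M A \<le> card A"
  using mrank_witness[OF assms(1), of A] card_mono[OF assms(2)] by metis

lemma indep_iff_mrank:
  assumes "is_matroid M" "finite I"
  shows "I \<in> indeps M \<longleftrightarrow> mrank M I = card I"
proof
  assume "I \<in> indeps M"
  then show "mrank M I = card I"
    using card_le_mrank[OF assms(1), of I I] mrank_le_card[OF assms] by auto
next
  assume *: "mrank M I = card I"
  obtain J where "J \<in> indeps M" "J \<subseteq> I" "card J = mrank M I"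
    using mrank_witness[OF assms(1)] .
  then show "I \<in> indeps M" using * card_subset_eq[OF assms(2)] by metis
qed

lemma mrank_submodular:
  assumes M: "is_matroid M"
  shows "mrank M (A \<union> B) + mrank M (A \<inter> B) \<le> mrank M A + mrank M B"
proof -
  obtain I where I: "I \<in> indeps M" "I \<subseteq> A \<inter> B" "card I = mrank M (A \<inter> B)"
    using mrank_witness[OF M] .
  obtain J where J: "J \<in> indeps M" "I \<subseteq> J" "J \<subseteq> A \<union> B" "card J = mrank M (A \<union> B)"
    using extend_indep[OF M I(1), of "A \<union> B"] I by blast
  have fin: "finite J" using finite_indep[OF M J(1)] .
  have sub: "J \<inter> A \<in> indeps M" "J \<inter> B \<in> indeps M"
    using M J(1) unfolding is_matroid_def by (meson inf_le1)+
  have "card J + card (J \<inter> A \<inter> (J \<inter> B)) = card (J \<inter> A) + card (J \<inter> B)"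
    using card_Un_Int[of "J \<inter> A" "J \<inter> B"] fin J(3)
    by (metis Int_Un_distrib finite_Int inf.absorb_iff1)
  moreover have "card I \<le> card (J \<inter> A \<inter> (J \<inter> B))"
    using I(2) J(2) fin by (intro card_mono) auto
  moreover have "card (J \<inter> A) \<le> mrank M A" "card (J \<inter> B) \<le> mrank M B"
    using card_le_mrank[OF M] sub by auto
  ultimately show ?thesis using I J by linarith
qed

lemma mrank_Un_le_card:
  assumes "is_matroid M" "finite X"
  shows "mrank M (A \<union> X) \<le> mrank M A + card X"
  using mrank_submodular[OF assms(1), of A X] mrank_le_card[OF assms] by linarith

lemma mrank_insert_mono:
  assumes M: "is_matroid M" and eq: "mrank M (insert x A) = mrank M A" and sub: "A \<subseteq> B"
  shows "mrank M (insert x B) = mrank M B"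
proof (cases "x \<in> B")
  case True then show ?thesis by (simp add: insert_absorb)
next
  case False
  have 1: "B \<union> insert x A = insert x B" "B \<inter> insert x A = A" using sub False by auto
  have "mrank M (insert x B) + mrank M A \<le> mrank M B + mrank M (insert x A)"
    using mrank_submodular[OF M, of B "insert x A"] unfolding 1 .
  then show ?thesis using eq mrank_mono[OF M, of B "insert x B"] by force
qed

lemma mrank_Un_eq:
  assumes M: "is_matroid M" and X: "finite X" "\<And>x. x \<in> X \<Longrightarrow> mrank M (insert x A) = mrank M A"
  shows "mrank M (A \<union> X) = mrank M A"
  using X
proof (induction X)
  case (insert x X)
  then have "mrank M (insert x (A \<union> X)) = mrank M (A \<union> X)"
    by (blast intro: mrank_insert_mono[OF M, where A = A])
  then show ?case using insert by simp
qed simp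

lemma ground_restriction [simp]: "ground (restriction M F) = F"
  and ground_contraction [simp]: "ground (contraction M F) = ground M - F"
  by (simp_all add: restriction_def contraction_def)

lemma mrank_restriction: "A \<subseteq> F \<Longrightarrow> mrank (restriction M F) A = mrank M A"
  unfolding mrank_def restriction_def
  by (intro arg_cong[where f = Max] arg_cong[where f = "image card"]) auto

lemma is_matroid_contraction:
  assumes M: "is_matroid M"
  shows "is_matroid (contraction M F)"
proof -
  let ?r = "mrank M"
  let ?C = "{I. I \<subseteq> ground M - F \<and> ?r (I \<union> F) = card I + ?r F}"
  have fg: "finite (ground M)" using M by (simp add: is_matroid_def)
  have fin: "finite I" if "I \<subseteq> ground M - F" for I
    using that fg by (meson finite_Diff finite_subset)
  have her: "J \<in> ?C" if I: "I \<in> ?C" and J: "J \<subseteq> I" for I J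
  proof -
    have fI: "finite I" "finite J" using I J fin finite_subset by auto
    have 1: "I \<union> F = (J \<union> F) \<union> (I - J)" using J by auto
    have "?r (I \<union> F) \<le> ?r (J \<union> F) + card (I - J)"
      unfolding 1 using mrank_Un_le_card[OF M, of "I - J"] fI by auto
    moreover have "card I = card J + card (I - J)"
      using J fI card_mono[OF fI(1) J] by (simp add: card_Diff_subset)
    moreover have "?r (J \<union> F) \<le> ?r F + card J"
      using mrank_Un_le_card[OF M fI(2), of F] by (simp add: Un_commute)
    ultimately show ?thesis using I J by auto
  qed
  have aug: "\<exists>x\<in>J - I. insert x I \<in> ?C" if I: "I \<in> ?C" and J: "J \<in> ?C" and lt: "card I < card J" for I J
  proof (rule ccontr)
    assume neg: "\<not> ?thesis"
    have fI: "finite I" "finite J" using I J fin by auto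
    have "?r (insert x (I \<union> F)) = ?r (I \<union> F)" if x: "x \<in> J - I" for x
    proof -
      have "insert x I \<notin> ?C" using neg x by blast
      moreover have "insert x I \<subseteq> ground M - F" using x I J by auto
      ultimately have "?r (insert x (I \<union> F)) \<noteq> Suc (card I) + ?r F" using x fI by auto
      moreover have "?r (insert x (I \<union> F)) \<le> Suc (?r (I \<union> F))"
        using mrank_Un_le_card[OF M, of "{x}" "I \<union> F"] by simp
      moreover have "?r (I \<union> F) \<le> ?r (insert x (I \<union> F))"
        by (rule mrank_mono[OF M]) auto
      ultimately show ?thesis using I by auto
    qed
    then have "?r (I \<union> F \<union> (J - I)) = ?r (I \<union> F)" using fI by (intro mrank_Un_eq[OF M]) auto
    moreover have "?r (J \<union> F) \<le> ?r (I \<union> F \<union> (J - I))" by (rule mrank_mono[OF M]) auto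
    ultimately show False using I J lt by auto
  qed
  show ?thesis
    unfolding is_matroid_def contraction_def matroid.sel
  proof (intro conjI ballI allI impI)
    show "J \<in> ?C" if "I \<in> ?C" "J \<subseteq> I" for I J using her that by blast
    show "\<exists>x\<in>J - I. insert x I \<in> ?C" if "I \<in> ?C" "J \<in> ?C" "card I < card J" for I J
      using aug that by blast
  qed (use fg in auto)
qed

lemma mrank_contraction:
  assumes M: "is_matroid M" and A: "A \<subseteq> ground M - F"
  shows "mrank (contraction M F) A = mrank M (A \<union> F) - mrank M F"
proof (rule antisym)
  have M': "is_matroid (contraction M F)" using is_matroid_contraction[OF M] .
  obtain I where I: "I \<in> indeps (contraction M F)" "I \<subseteq> A" "card I = mrank (contraction M F) A"
    using mrank_witness[OF M'] .
  have "mrank M (I \<union> F) = card I + mrank M F" using I(1) by (simp add: contraction_def)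
  moreover have "mrank M (I \<union> F) \<le> mrank M (A \<union> F)" using I by (intro mrank_mono[OF M]) auto
  ultimately show "mrank (contraction M F) A \<le> mrank M (A \<union> F) - mrank M F" using I by linarith
next
  have M': "is_matroid (contraction M F)" using is_matroid_contraction[OF M] .
  obtain B where B: "B \<in> indeps M" "B \<subseteq> F" "card B = mrank M F" using mrank_witness[OF M] .
  obtain J where J: "J \<in> indeps M" "B \<subseteq> J" "J \<subseteq> A \<union> F" "card J = mrank M (A \<union> F)"
    using extend_indep[OF M B(1), of "A \<union> F"] B by blast
  have fJ: "finite J" using finite_indep[OF M J(1)] .
  have "J \<inter> F \<in> indeps M" using M J(1) unfolding is_matroid_def by (meson inf_le1)
  then have "card (J \<inter> F) \<le> mrank M F" by (intro card_le_mrank[OF M]) auto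
  moreover have "card B \<le> card (J \<inter> F)" using B J fJ by (intro card_mono) auto
  ultimately have JF: "card (J \<inter> F) = mrank M F" using B by auto
  have "card J = card (J \<inter> F) + card (J - F)" using fJ
    by (metis card_Int_Diff)
  then have cI: "card J = card (J - F) + mrank M F" using JF by simp
  have "mrank M ((J - F) \<union> F) \<ge> card J" using J by (intro card_le_mrank[OF M]) auto
  moreover have "mrank M ((J - F) \<union> F) \<le> mrank M F + card (J - F)"
    using mrank_Un_le_card[OF M, of "J - F" F] fJ by (simp add: Un_commute)
  ultimately have "J - F \<in> indeps (contraction M F)"
    using cI J A by (auto simp: contraction_def)
  then have "card (J - F) \<le> mrank (contraction M F) A"
    using J by (intro card_le_mrank[OF M']) auto
  then show "mrank M (A \<union> F) - mrank M F \<le> mrank (contraction M F) A" using cI J by linarith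
qed

lemma contraction_contraction:
  assumes M: "is_matroid M" and FG: "F \<subseteq> G" "G \<subseteq> ground M"
  shows "contraction (contraction M F) (G - F) = contraction M G"
proof -
  have g: "ground M - F - (G - F) = ground M - G" using FG by auto
  have "mrank (contraction M F) (I \<union> (G - F)) = card I + mrank (contraction M F) (G - F)
      \<longleftrightarrow> mrank M (I \<union> G) = card I + mrank M G" if I: "I \<subseteq> ground M - G" for I
  proof -
    have 1: "mrank (contraction M F) (I \<union> (G - F)) = mrank M (I \<union> (G - F) \<union> F) - mrank M F"
      "mrank (contraction M F) (G - F) = mrank M (G - F \<union> F) - mrank M F"
      using I FG by (intro mrank_contraction[OF M]; auto)+
    have 2: "I \<union> (G - F) \<union> F = I \<union> G" "G - F \<union> F = G" using FG by auto
    show ?thesis unfolding 1 2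
      using mrank_mono[OF M, of F G] mrank_mono[OF M, of F "I \<union> G"] FG
        mrank_mono[OF M, of G "I \<union> G"] by (simp add: le_supI2) linarith
  qed
  then show ?thesis
    unfolding contraction_def[of "contraction M F"] ground_contraction g
    by (auto simp: contraction_def[of M G])
qed

lemma mrank_empty [simp]: "is_matroid M \<Longrightarrow> mrank M {} = 0"
  using mrank_le_card[of M "{}"] by simp

lemma contraction_empty:
  assumes M: "is_matroid M" shows "contraction M {} = M"
proof -
  have fg: "finite (ground M)" and sub: "indeps M \<subseteq> Pow (ground M)"
    using M by (simp_all add: is_matroid_def)
  have "I \<subseteq> ground M \<and> mrank M I = card I \<longleftrightarrow> I \<in> indeps M" for I
    using indep_iff_mrank[OF M, of I] fg sub finite_subset by blast
  then show ?thesis using M by (intro matroid.expand) (simp add: contraction_def)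
qed

lemma flats_contraction:
  assumes M: "is_matroid M" and F: "F \<subseteq> ground M"
  shows "flats (contraction M F) = (\<lambda>H. H - F) ` {H \<in> flats M. F \<subseteq> H}"
proof -
  have key: "K \<in> flats (contraction M F) \<longleftrightarrow> K \<union> F \<in> flats M" if K: "K \<subseteq> ground M - F" for K
  proof -
    have 1: "mrank (contraction M F) K = mrank M (K \<union> F) - mrank M F"
      using mrank_contraction[OF M K] .
    have 2: "mrank (contraction M F) (insert x K) = mrank M (insert x (K \<union> F)) - mrank M F"
      if "x \<in> ground M - F" for x
      using mrank_contraction[OF M, of "insert x K" F] K that by auto
    have 3: "mrank M F \<le> mrank M (K \<union> F)" by (rule mrank_mono[OF M]) auto
    have 4: "ground M - F - K = ground M - (K \<union> F)" by auto
    have "mrank (contraction M F) K < mrank (contraction M F) (insert x K) \<longleftrightarrow>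
      mrank M (K \<union> F) < mrank M (insert x (K \<union> F))" if "x \<in> ground M - F - K" for x
      using 1 2[of x] 3 that by auto
    then show ?thesis unfolding flats_def ground_contraction using K F 4 by auto
  qed
  show ?thesis
  proof (intro equalityI subsetI)
    fix K assume K: "K \<in> flats (contraction M F)"
    then have sub: "K \<subseteq> ground M - F" by (auto simp: flats_def)
    have "K = (K \<union> F) - F" using sub by auto
    then show "K \<in> (\<lambda>H. H - F) ` {H \<in> flats M. F \<subseteq> H}" using key[OF sub] K by blast
  next
    fix K assume "K \<in> (\<lambda>H. H - F) ` {H \<in> flats M. F \<subseteq> H}"
    then obtain H where H: "H \<in> flats M" "F \<subseteq> H" "K = H - F" by auto
    then have "K \<subseteq> ground M - F" "K \<union> F = H" by (auto simp: flats_def)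
    then show "K \<in> flats (contraction M F)" using key H by auto
  qed
qed

lemma flats_restriction:
  assumes M: "is_matroid M" and F: "F \<in> flats M"
  shows "flats (restriction M F) = {H \<in> flats M. H \<subseteq> F}"
proof -
  have "H \<in> flats (restriction M F) \<longleftrightarrow> H \<in> flats M" if H: "H \<subseteq> F" for H
  proof
    assume h: "H \<in> flats (restriction M F)"
    have "mrank M H < mrank M (insert x H)" if x: "x \<in> ground M - H" for x
    proof (cases "x \<in> F")
      case True
      then show ?thesis using h x H by (auto simp: flats_def mrank_restriction)
    next
      case False
      then have "mrank M F < mrank M (insert x F)" using F x by (auto simp: flats_def)
      then have "mrank M (insert x H) \<noteq> mrank M H" using mrank_insert_mono[OF M _ H] by force
      moreover have "mrank M H \<le> mrank M (insert x H)" by (rule mrank_mono[OF M]) auto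
      ultimately show ?thesis by simp
    qed
    then show "H \<in> flats M" using H F by (auto simp: flats_def)
  next
    assume "H \<in> flats M"
    then show "H \<in> flats (restriction M F)"
      using H F by (auto simp: flats_def mrank_restriction)
  qed
  then show ?thesis by (auto simp: flats_def)
qed

lemma loopless_contraction:
  assumes M: "is_matroid M" and F: "F \<in> flats M"
  shows "loopless (contraction M F)"
proof -
  have "mrank M (insert x F) = Suc (mrank M F)" if "x \<in> ground M - F" for x
    using that F mrank_Un_le_card[OF M, of "{x}" F] by (force simp: flats_def)
  then show ?thesis by (auto simp: loopless_def contraction_def)
qed

lemma empty_flat:
  assumes "is_matroid M" "loopless M" shows "{} \<in> flats M"
  using assms indep_iff_mrank[OF assms(1)] by (auto simp: flats_def loopless_def)

lemma ground_flat: "ground M \<in> flats M"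
  by (simp add: flats_def)

lemma finite_flats: "is_matroid M \<Longrightarrow> finite (flats M)"
  by (rule finite_subset[of _ "Pow (ground M)"]) (auto simp: flats_def is_matroid_def)

lemma finite_flat: "is_matroid M \<Longrightarrow> F \<in> flats M \<Longrightarrow> finite F"
  by (auto simp: flats_def is_matroid_def intro: finite_subset)

lemma mobius_self [simp]: "mobius L F F = 1"
  by (subst mobius.simps) simp

lemma sum_mobius:
  assumes "finite L" "finite G" "F \<in> L" "G \<in> L"
  shows "(\<Sum>H\<in>{H\<in>L. F \<subseteq> H \<and> H \<subseteq> G}. mobius L F H) = (if F = G then 1 else 0)"
proof (cases "F \<subset> G")
  case True
  have "{H\<in>L. F \<subseteq> H \<and> H \<subseteq> G} = insert G {H\<in>L. F \<subseteq> H \<and> H \<subset> G}"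
    using True assms by auto
  then have "(\<Sum>H\<in>{H\<in>L. F \<subseteq> H \<and> H \<subseteq> G}. mobius L F H) =
      mobius L F G + (\<Sum>H\<in>{H\<in>L. F \<subseteq> H \<and> H \<subset> G}. mobius L F H)"
    using assms by simp
  also have "mobius L F G = - (\<Sum>H\<in>{H\<in>L. F \<subseteq> H \<and> H \<subset> G}. mobius L F H)"
    using True assms by (subst mobius.simps) auto
  finally show ?thesis using True by auto
next
  case False
  show ?thesis
  proof (cases "F = G")
    case True
    then have "{H\<in>L. F \<subseteq> H \<and> H \<subseteq> G} = {F}" using assms by auto
    then show ?thesis using True by simp
  next
    case 2: False
    then have e: "{H\<in>L. F \<subseteq> H \<and> H \<subseteq> G} = {}" using False by auto
    show ?thesis unfolding e using 2 by simp
  qed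
qed

text \<open>The dual recursion, obtained by comparison with the Moebius function of the family
  of complements.\<close>

lemma sum_mobius_dual:
  assumes fin: "finite L" "finite E" and L: "L \<subseteq> Pow E" and FG: "F \<in> L" "G \<in> L"
  shows "(\<Sum>H\<in>{H\<in>L. F \<subseteq> H \<and> H \<subseteq> G}. mobius L H G) = (if F = G then 1 else 0)"
proof -
  define L' where "L' = (\<lambda>H. E - H) ` L"
  define nu where "nu F G = mobius L' (E - G) (E - F)" for F G
  have inj: "inj_on (\<lambda>H. E - H) L" using L by (intro inj_onI) blast
  have fL: "finite A" if "A \<in> L" for A using that L fin finite_subset by blast
  have nu: "(\<Sum>H\<in>{H\<in>L. A \<subseteq> H \<and> H \<subseteq> B}. nu H B) = (if A = B then 1 else 0)"
    if AB: "A \<in> L" "B \<in> L" for A B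
  proof -
    have im: "{K\<in>L'. E - B \<subseteq> K \<and> K \<subseteq> E - A} = (\<lambda>H. E - H) ` {H\<in>L. A \<subseteq> H \<and> H \<subseteq> B}"
    proof -
      have "E - B \<subseteq> E - H \<and> E - H \<subseteq> E - A \<longleftrightarrow> A \<subseteq> H \<and> H \<subseteq> B" if "H \<in> L" for H
        using that AB L by blast
      then show ?thesis unfolding L'_def by auto
    qed
    have "(\<Sum>K\<in>{K\<in>L'. E - B \<subseteq> K \<and> K \<subseteq> E - A}. mobius L' (E - B) K) =
        (if E - B = E - A then 1 else 0)"
      using AB fin by (intro sum_mobius) (auto simp: L'_def)
    moreover have "E - B = E - A \<longleftrightarrow> A = B" using AB inj by (auto dest: inj_onD)
    moreover have "inj_on (\<lambda>H. E - H) {H\<in>L. A \<subseteq> H \<and> H \<subseteq> B}"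
      using inj by (rule inj_on_subset) auto
    ultimately show ?thesis unfolding im nu_def by (simp add: sum.reindex)
  qed
  have eq: "mobius L A B = nu A B" if AB: "A \<in> L" "B \<in> L" "A \<subseteq> B" for A B
  proof -
    let ?I = "\<lambda>A B. {H\<in>L. A \<subseteq> H \<and> H \<subseteq> B}"
    have fI: "finite (?I A B)" for A B using fin by auto
    have "(\<Sum>H\<in>?I A B. \<Sum>K\<in>?I H B. mobius L A H * nu K B) =
        (\<Sum>K\<in>?I A B. \<Sum>H\<in>?I A K. mobius L A H * nu K B)"
      unfolding sum.Sigma[OF fI[of A B] ballI, OF fI]
      by (rule sum.reindex_bij_witness[where i = "\<lambda>(a, b). (b, a)" and j = "\<lambda>(a, b). (b, a)"]) auto
    moreover have "(\<Sum>H\<in>?I A B. \<Sum>K\<in>?I H B. mobius L A H * nu K B) = mobius L A B"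
    proof -
      have "(\<Sum>H\<in>?I A B. \<Sum>K\<in>?I H B. mobius L A H * nu K B) =
          (\<Sum>H\<in>?I A B. if H = B then mobius L A H else 0)"
        using AB by (intro sum.cong refl) (simp add: nu sum_distrib_left[symmetric])
      then show ?thesis using AB fI by simp
    qed
    moreover have "(\<Sum>K\<in>?I A B. \<Sum>H\<in>?I A K. mobius L A H * nu K B) = nu A B"
    proof -
      have "(\<Sum>K\<in>?I A B. \<Sum>H\<in>?I A K. mobius L A H * nu K B) =
          (\<Sum>K\<in>?I A B. if A = K then nu K B else 0)"
        using AB fin fL by (intro sum.cong refl) (simp add: sum_mobius sum_distrib_right[symmetric])
      then show ?thesis using AB fI by simp
    qed
    ultimately show ?thesis by simp
  qed
  have "(\<Sum>H\<in>{H\<in>L. F \<subseteq> H \<and> H \<subseteq> G}. mobius L H G) = (\<Sum>H\<in>{H\<in>L. F \<subseteq> H \<and> H \<subseteq> G}. nu H G)"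
    using FG eq by (intro sum.cong) auto
  then show ?thesis using nu FG by simp
qed

lemma mobius_interval:
  assumes "finite G" "F \<subseteq> G" "G \<subseteq> T"
  shows "mobius ((\<lambda>H. H - F) ` {H\<in>L. F \<subseteq> H \<and> H \<subseteq> T}) {} (G - F) = mobius L F G"
  using assms
proof (induction "card G" arbitrary: G rule: less_induct)
  case less
  let ?L = "(\<lambda>H. H - F) ` {H\<in>L. F \<subseteq> H \<and> H \<subseteq> T}"
  show ?case
  proof (cases "F = G")
    case False
    then have ps: "F \<subset> G" using less by auto
    have im: "{K\<in>?L. {} \<subseteq> K \<and> K \<subset> G - F} = (\<lambda>H. H - F) ` {H\<in>L. F \<subseteq> H \<and> H \<subset> G}"
    proof -
      have 1: "H - F \<subset> G - F \<longleftrightarrow> H \<subset> G" if "F \<subseteq> H" for H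
        using that less.prems(2) by blast
      have "{K\<in>?L. {} \<subseteq> K \<and> K \<subset> G - F} =
          (\<lambda>H. H - F) ` {H\<in>L. F \<subseteq> H \<and> H \<subseteq> T \<and> H - F \<subset> G - F}"
        by blast
      also have "{H\<in>L. F \<subseteq> H \<and> H \<subseteq> T \<and> H - F \<subset> G - F} = {H\<in>L. F \<subseteq> H \<and> H \<subset> G}"
        using 1 less.prems(3) by (intro Collect_cong) (meson order_trans psubset_imp_subset)
      finally show ?thesis .
    qed
    have inj: "inj_on (\<lambda>H. H - F) {H\<in>L. F \<subseteq> H \<and> H \<subset> G}"
      by (intro inj_onI) blast
    have "mobius ?L {} (G - F) = - (\<Sum>K\<in>{K\<in>?L. {} \<subseteq> K \<and> K \<subset> G - F}. mobius ?L {} K)"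
      using ps less.prems by (subst mobius.simps) auto
    also have "\<dots> = - (\<Sum>H\<in>{H\<in>L. F \<subseteq> H \<and> H \<subset> G}. mobius ?L {} (H - F))"
      unfolding im using inj by (simp add: sum.reindex)
    also have "\<dots> = - (\<Sum>H\<in>{H\<in>L. F \<subseteq> H \<and> H \<subset> G}. mobius L F H)"
    proof -
      have "mobius ?L {} (H - F) = mobius L F H" if "H \<in> {H\<in>L. F \<subseteq> H \<and> H \<subset> G}" for H
        using that less.prems
        by (intro less.hyps) (auto intro: psubset_card_mono finite_subset[of H G])
      then show ?thesis by simp
    qed
    also have "\<dots> = mobius L F G"
      using ps less.prems by (subst (2) mobius.simps) auto
    finally show ?thesis .
  qed simp
qed

lemma coeff_rev_poly: "coeff (rev_poly n p) k = (if k \<le> n then coeff p (n - k) else 0)"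
proof -
  have "coeff (rev_poly n p) k = (\<Sum>i\<le>n. if n - i = k then coeff p i else 0)"
    by (simp add: rev_poly_def coeff_sum)
  also have "\<dots> = (\<Sum>i\<le>n. if i = n - k \<and> k \<le> n then coeff p i else 0)"
    by (intro sum.cong) auto
  also have "\<dots> = (if k \<le> n then coeff p (n - k) else 0)"
    by (cases "k \<le> n") auto
  finally show ?thesis .
qed

lemma rev_poly_sum: "rev_poly n (\<Sum>x\<in>A. f x) = (\<Sum>x\<in>A. rev_poly n (f x))"
  by (intro poly_eqI) (simp add: coeff_rev_poly coeff_sum)

lemma rev_poly_diff: "rev_poly n (p - q) = rev_poly n p - rev_poly n q"
  by (intro poly_eqI) (simp add: coeff_rev_poly)

lemma rev_poly_monom: "k \<le> n \<Longrightarrow> rev_poly n (monom a k) = monom a (n - k)"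
  by (intro poly_eqI) (auto simp: coeff_rev_poly)

lemma rev_poly_reflect:
  assumes "degree p \<le> n"
  shows "rev_poly n p = monom 1 (n - degree p) * reflect_poly p"
  using assms
  by (intro poly_eqI) (auto simp: coeff_rev_poly coeff_monom_mult coeff_reflect_poly coeff_eq_0)

lemma rev_poly_mult:
  assumes "degree p \<le> m" "degree q \<le> n"
  shows "rev_poly (m + n) (p * q) = rev_poly m p * rev_poly n q"
proof (cases "p = 0 \<or> q = 0")
  case True
  then show ?thesis by (auto simp: rev_poly_def)
next
  case False
  then have d: "degree (p * q) = degree p + degree q" by (simp add: degree_mult_eq)
  have "m + n - (degree p + degree q) = (m - degree p) + (n - degree q)" using assms by simp
  then have "monom (1 :: int) (m + n - (degree p + degree q)) =
      monom 1 (m - degree p) * monom 1 (n - degree q)"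
    by (simp add: mult_monom)
  then show ?thesis
    using assms d by (simp add: rev_poly_reflect reflect_poly_mult mult_ac)
qed

lemma rev_poly_eq_self:
  assumes "rev_poly n p = p" "2 * degree p < n"
  shows "p = 0"
proof (rule poly_eqI)
  fix k
  have "coeff p k = (if k \<le> n then coeff p (n - k) else 0)" using assms(1) coeff_rev_poly by metis
  then show "coeff p k = coeff 0 k"
    using assms(2) by (cases "2 * k < n") (auto simp: coeff_eq_0)
qed

definition interval_poly :: "'a matroid \<Rightarrow> 'a set \<Rightarrow> 'a set \<Rightarrow> int poly" where
  "interval_poly M F G =
     (\<Sum>H\<in>{H\<in>flats M. F \<subseteq> H \<and> H \<subseteq> G}. monom (mobius (flats M) F H) (mrank M G - mrank M H))"

lemma characteristic_poly_interval:
  assumes M: "is_matroid M" and FG: "F \<in> flats M" "G \<in> flats M" "F \<subseteq> G"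
  shows "characteristic_poly (restriction (contraction M F) (G - F)) = interval_poly M F G"
proof -
  let ?N = "contraction M F"
  let ?S = "{H\<in>flats M. F \<subseteq> H \<and> H \<subseteq> G}"
  have N: "is_matroid ?N" using is_matroid_contraction[OF M] .
  have F: "F \<subseteq> ground M" and G: "G \<subseteq> ground M" using FG by (auto simp: flats_def)
  have flN: "flats ?N = (\<lambda>H. H - F) ` {H \<in> flats M. F \<subseteq> H}" using flats_contraction[OF M F] .
  have GN: "G - F \<in> flats ?N" unfolding flN using FG by auto
  have fl: "flats (restriction ?N (G - F)) = (\<lambda>H. H - F) ` ?S"
  proof -
    have "H - F \<subseteq> G - F \<longleftrightarrow> H \<subseteq> G" if "F \<subseteq> H" for H
      using that FG(3) by blast
    then show ?thesis unfolding flats_restriction[OF N GN] flN by blast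
  qed
  have inj: "inj_on (\<lambda>H. H - F) ?S" by (intro inj_onI) blast
  have rk: "mrank (restriction ?N (G - F)) (H - F) = mrank M H - mrank M F" if "F \<subseteq> H" "H \<subseteq> G" for H
  proof -
    have 1: "mrank (restriction ?N (G - F)) (H - F) = mrank ?N (H - F)"
      using that by (intro mrank_restriction) auto
    have "H - F \<union> F = H" using that by auto
    then show ?thesis unfolding 1 using mrank_contraction[OF M, of "H - F" F] that G by auto
  qed
  have "characteristic_poly (restriction ?N (G - F)) =
      (\<Sum>H\<in>?S. monom (mobius ((\<lambda>H. H - F) ` ?S) {} (H - F))
          (rk (restriction ?N (G - F)) - mrank (restriction ?N (G - F)) (H - F)))"
    unfolding characteristic_poly_def fl using inj by (simp add: sum.reindex)
  also have "\<dots> = interval_poly M F G"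
    unfolding interval_poly_def
  proof (rule sum.cong[OF refl])
    fix H assume H: "H \<in> ?S"
    have "mobius ((\<lambda>H. H - F) ` ?S) {} (H - F) = mobius (flats M) F H"
      using H finite_flat[OF M] by (intro mobius_interval) auto
    moreover have "rk (restriction ?N (G - F)) - mrank (restriction ?N (G - F)) (H - F) =
        mrank M G - mrank M H"
      using rk[of H] rk[of G] H FG mrank_mono[OF M, of F H] by simp
    ultimately show "monom (mobius ((\<lambda>H. H - F) ` ?S) {} (H - F))
          (rk (restriction ?N (G - F)) - mrank (restriction ?N (G - F)) (H - F)) =
        monom (mobius (flats M) F H) (mrank M G - mrank M H)" by simp
  qed
  finally show ?thesis .
qed

lemma characteristic_poly_restriction:
  assumes "is_matroid M" "loopless M" "G \<in> flats M"
  shows "characteristic_poly (restriction M G) = interval_poly M {} G"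
  using characteristic_poly_interval[OF assms(1) empty_flat[OF assms(1,2)] assms(3)]
  by (simp add: contraction_empty[OF assms(1)])

lemma interval_poly_self: "F \<in> flats M \<Longrightarrow> interval_poly M F F = 1"
proof -
  assume "F \<in> flats M"
  then have "{H\<in>flats M. F \<subseteq> H \<and> H \<subseteq> F} = {F}" by auto
  then show ?thesis by (simp add: interval_poly_def)
qed

lemma degree_interval_poly:
  assumes M: "is_matroid M"
  shows "degree (interval_poly M F G) \<le> mrank M G - mrank M F"
  unfolding interval_poly_def
proof (rule degree_sum_le)
  show "finite {H \<in> flats M. F \<subseteq> H \<and> H \<subseteq> G}" using finite_flats[OF M] by simp
  fix H assume "H \<in> {H \<in> flats M. F \<subseteq> H \<and> H \<subseteq> G}"
  then have "mrank M F \<le> mrank M H" by (intro mrank_mono[OF M]) auto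
  then show "degree (monom (mobius (flats M) F H) (mrank M G - mrank M H)) \<le> mrank M G - mrank M F"
    using degree_monom_le[of "mobius (flats M) F H" "mrank M G - mrank M H"] by linarith
qed

lemma rev_interval_poly:
  assumes M: "is_matroid M"
  shows "rev_poly (mrank M G - mrank M F) (interval_poly M F G) =
    (\<Sum>H\<in>{H\<in>flats M. F \<subseteq> H \<and> H \<subseteq> G}. monom (mobius (flats M) F H) (mrank M H - mrank M F))"
  unfolding interval_poly_def rev_poly_sum
proof (rule sum.cong[OF refl])
  fix H assume "H \<in> {H\<in>flats M. F \<subseteq> H \<and> H \<subseteq> G}"
  then have "mrank M F \<le> mrank M H" "mrank M H \<le> mrank M G" by (auto intro!: mrank_mono[OF M])
  then show "rev_poly (mrank M G - mrank M F) (monom (mobius (flats M) F H) (mrank M G - mrank M H)) =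
      monom (mobius (flats M) F H) (mrank M H - mrank M F)"
    by (subst rev_poly_monom) auto
qed

lemma interval_poly_kernel:
  assumes M: "is_matroid M" and AG: "A \<in> flats M" "G \<in> flats M" "A \<subseteq> G"
  shows "(\<Sum>F\<in>{F\<in>flats M. A \<subseteq> F \<and> F \<subseteq> G}.
      rev_poly (mrank M F - mrank M A) (interval_poly M A F) * interval_poly M F G) =
    (if A = G then 1 else 0)"
proof -
  let ?L = "flats M" and ?r = "mrank M"
  let ?I = "\<lambda>A B. {H\<in>?L. A \<subseteq> H \<and> H \<subseteq> B}"
  let ?m = "mobius ?L"
  have fI: "finite (?I A B)" for A B using finite_flats[OF M] by simp
  have fE: "finite (ground M)" using M by (simp add: is_matroid_def)
  have LE: "?L \<subseteq> Pow (ground M)" by (auto simp: flats_def)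
  let ?t = "\<lambda>H F K. monom (?m A H * ?m F K) (?r H - ?r A + (?r G - ?r K))"
  have "(\<Sum>F\<in>?I A G. rev_poly (?r F - ?r A) (interval_poly M A F) * interval_poly M F G) =
      (\<Sum>F\<in>?I A G. \<Sum>H\<in>?I A F. \<Sum>K\<in>?I F G. ?t H F K)"
    unfolding rev_interval_poly[OF M] by (simp add: interval_poly_def sum_product mult_monom)
  also have "\<dots> = (\<Sum>(F, H, K)\<in>(SIGMA F:?I A G. ?I A F \<times> ?I F G). ?t H F K)"
    using fI by (simp add: sum.Sigma sum.cartesian_product)
  also have "\<dots> = (\<Sum>(H, K, F)\<in>(SIGMA H:?I A G. SIGMA K:?I H G. ?I H K). ?t H F K)"
    by (rule sum.reindex_bij_witness[where i = "\<lambda>(H, K, F). (F, H, K)" and j = "\<lambda>(F, H, K). (H, K, F)"])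
       auto
  also have "\<dots> = (\<Sum>H\<in>?I A G. \<Sum>K\<in>?I H G. \<Sum>F\<in>?I H K. ?t H F K)"
    using fI by (simp add: sum.Sigma)
  also have "\<dots> = (\<Sum>H\<in>?I A G. monom (?m A H) (?r G - ?r A))"
  proof (rule sum.cong[OF refl])
    fix H assume H: "H \<in> ?I A G"
    have "(\<Sum>K\<in>?I H G. \<Sum>F\<in>?I H K. ?t H F K) =
        (\<Sum>K\<in>?I H G. if H = K then monom (?m A H) (?r H - ?r A + (?r G - ?r K)) else 0)"
    proof (rule sum.cong[OF refl])
      fix K assume K: "K \<in> ?I H G"
      have "(\<Sum>F\<in>?I H K. ?t H F K) = monom (?m A H * (\<Sum>F\<in>?I H K. ?m F K)) (?r H - ?r A + (?r G - ?r K))"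
        by (intro poly_eqI) (simp add: coeff_sum sum_distrib_left)
      also have "(\<Sum>F\<in>?I H K. ?m F K) = (if H = K then 1 else 0)"
        using H K finite_flats[OF M] fE LE by (intro sum_mobius_dual) auto
      finally show "(\<Sum>F\<in>?I H K. ?t H F K) =
          (if H = K then monom (?m A H) (?r H - ?r A + (?r G - ?r K)) else 0)"
        by auto
    qed
    also have "\<dots> = monom (?m A H) (?r H - ?r A + (?r G - ?r H))"
      using H fI by simp
    also have "?r H - ?r A + (?r G - ?r H) = ?r G - ?r A"
      using H mrank_mono[OF M, of A H] mrank_mono[OF M, of H G] by simp
    finally show "(\<Sum>K\<in>?I H G. \<Sum>F\<in>?I H K. ?t H F K) = monom (?m A H) (?r G - ?r A)" .
  qed
  also have "\<dots> = monom (\<Sum>H\<in>?I A G. ?m A H) (?r G - ?r A)"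
    by (intro poly_eqI) (simp add: coeff_sum)
  also have "(\<Sum>H\<in>?I A G. ?m A H) = (if A = G then 1 else 0)"
    using AG finite_flats[OF M] finite_flat[OF M] by (intro sum_mobius) auto
  finally show ?thesis by auto
qed

lemma kl_sum_split:
  assumes M: "is_matroid M" "loopless M"
  shows "(\<Sum>F\<in>flats M. characteristic_poly (restriction M F) * P (contraction M F)) =
    P M + (\<Sum>F\<in>flats M - {{}}. interval_poly M {} F * P (contraction M F))"
proof -
  have "(\<Sum>F\<in>flats M. characteristic_poly (restriction M F) * P (contraction M F)) =
      (\<Sum>F\<in>flats M. interval_poly M {} F * P (contraction M F))"
    using characteristic_poly_restriction[OF M] by simp
  also have "\<dots> = interval_poly M {} {} * P (contraction M {}) +
      (\<Sum>F\<in>flats M - {{}}. interval_poly M {} F * P (contraction M F))"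
    by (rule sum.remove) (auto simp: finite_flats[OF M(1)] empty_flat[OF M])
  finally show ?thesis
    by (simp add: interval_poly_self empty_flat[OF M] contraction_empty[OF M(1)])
qed

lemma card_contraction_less:
  assumes "is_matroid M" "F \<in> flats M - {{}}"
  shows "card (ground (contraction M F)) < card (ground M)"
  using assms by (auto simp: flats_def is_matroid_def intro!: psubset_card_mono)

lemma kl_assignment_unique:
  assumes "kl_assignment P" "kl_assignment Q" "is_matroid M" "loopless M"
  shows "P M = Q M"
  using assms(3,4)
proof (induction "card (ground M)" arbitrary: M rule: less_induct)
  case less
  note M = less.prems
  have eqs: "P (contraction M F) = Q (contraction M F)" if F: "F \<in> flats M - {{}}" for F
    using less.hyps[OF card_contraction_less[OF M(1) F]] is_matroid_contraction[OF M(1)]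
      loopless_contraction[OF M(1)] F by auto
  have P: "rev_poly (rk M) (P M) = P M + (\<Sum>F\<in>flats M - {{}}. interval_poly M {} F * P (contraction M F))"
    and Q: "rev_poly (rk M) (Q M) = Q M + (\<Sum>F\<in>flats M - {{}}. interval_poly M {} F * Q (contraction M F))"
    using assms(1,2) M unfolding kl_assignment_def kl_sum_split[OF M, symmetric] by blast+
  show ?case
  proof (cases "rk M = 0")
    case True
    then show ?thesis using assms(1,2) M unfolding kl_assignment_def by simp
  next
    case False
    then have d: "2 * degree (P M) < rk M" "2 * degree (Q M) < rk M"
      using assms(1,2) M unfolding kl_assignment_def by auto
    have "rev_poly (rk M) (P M - Q M) = P M - Q M"
      using P Q eqs by (simp add: rev_poly_diff)
    moreover have "2 * degree (P M - Q M) < rk M"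
      using d degree_diff_le_max[of "P M" "Q M"] by linarith
    ultimately show ?thesis using rev_poly_eq_self by fastforce
  qed
qed

function kl_rec :: "'a matroid \<Rightarrow> int poly" where
  "kl_rec M =
     (if \<not> is_matroid M \<or> rk M = 0 then 1
      else \<Sum>i\<in>{i. 2 * i < rk M}. monom (coeff
        (\<Sum>F\<in>flats M - {{}}. interval_poly M {} F * kl_rec (contraction M F)) (rk M - i)) i)"
  by auto
termination
  by (relation "measure (\<lambda>M. card (ground M))")
     (auto intro!: card_contraction_less[simplified ground_contraction])

declare kl_rec.simps [simp del]

lemma kl_rec_correct:
  assumes "is_matroid M" "loopless M"
  shows "(rk M = 0 \<longrightarrow> kl_rec M = 1) \<and>
    (rk M > 0 \<longrightarrow> 2 * degree (kl_rec M) < rk M) \<and>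
    rev_poly (rk M) (kl_rec M) =
      (\<Sum>F\<in>flats M. characteristic_poly (restriction M F) * kl_rec (contraction M F))"
  using assms
proof (induction "card (ground M)" arbitrary: M rule: less_induct)
  case less
  note M = less.prems
  let ?L = "flats M" and ?r = "mrank M" and ?chi = "interval_poly M"
  define Q where "Q F = kl_rec (contraction M F)" for F
  define R where "R = (\<Sum>F\<in>?L - {{}}. ?chi {} F * Q F)"
  have fL: "finite ?L" using finite_flats[OF M(1)] .
  have rkC: "rk (contraction M F) = rk M - ?r F" if "F \<in> ?L" for F
  proof -
    have "ground M - F \<union> F = ground M" using that by (auto simp: flats_def)
    then show ?thesis using mrank_contraction[OF M(1), of "ground M - F" F] by simp
  qed
  have rle: "?r F \<le> rk M" if "F \<in> ?L" for F
    using that by (intro mrank_mono[OF M(1)]) (auto simp: flats_def)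
  have good: "is_matroid (contraction M F)" "loopless (contraction M F)" if "F \<in> ?L" for F
    using is_matroid_contraction[OF M(1)] loopless_contraction[OF M(1) that] by auto
  have degQ: "degree (Q F) \<le> rk M - ?r F" if F: "F \<in> ?L - {{}}" for F
    using less.hyps[OF card_contraction_less[OF M(1) F]] good[of F] F rkC[of F]
    unfolding Q_def by (cases "rk (contraction M F) = 0") auto
  have revQ: "rev_poly (rk M - ?r F) (Q F) = (\<Sum>G\<in>{G\<in>?L. F \<subseteq> G}. ?chi F G * Q G)"
    if F: "F \<in> ?L - {{}}" for F
  proof -
    let ?N = "contraction M F"
    have sub: "F \<subseteq> ground M" using F by (auto simp: flats_def)
    have inj: "inj_on (\<lambda>H. H - F) {G \<in> ?L. F \<subseteq> G}" by (intro inj_onI) blast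
    have "rev_poly (rk M - ?r F) (Q F) =
        (\<Sum>K\<in>flats ?N. characteristic_poly (restriction ?N K) * kl_rec (contraction ?N K))"
      using less.hyps[OF card_contraction_less[OF M(1) F]] good[of F] F rkC[of F]
      unfolding Q_def by auto
    also have "\<dots> = (\<Sum>G\<in>{G\<in>?L. F \<subseteq> G}.
        characteristic_poly (restriction ?N (G - F)) * kl_rec (contraction ?N (G - F)))"
      unfolding flats_contraction[OF M(1) sub] using inj by (simp add: sum.reindex)
    also have "\<dots> = (\<Sum>G\<in>{G\<in>?L. F \<subseteq> G}. ?chi F G * Q G)"
    proof (rule sum.cong[OF refl])
      fix G assume G: "G \<in> {G\<in>?L. F \<subseteq> G}"
      then have "contraction ?N (G - F) = contraction M G"
        by (intro contraction_contraction[OF M(1)]) (auto simp: flats_def)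
      then show "characteristic_poly (restriction ?N (G - F)) * kl_rec (contraction ?N (G - F)) =
          ?chi F G * Q G"
        using characteristic_poly_interval[OF M(1), of F G] F G by (simp add: Q_def)
    qed
    finally show ?thesis .
  qed
  have revR: "rev_poly (rk M) R = - R"
  proof -
    let ?b = "\<lambda>F. rev_poly (?r F - ?r {}) (?chi {} F)"
    have "rev_poly (rk M) R = (\<Sum>F\<in>?L - {{}}. ?b F * rev_poly (rk M - ?r F) (Q F))"
      unfolding R_def rev_poly_sum
    proof (rule sum.cong[OF refl])
      fix F assume F: "F \<in> ?L - {{}}"
      have "rev_poly (?r F + (rk M - ?r F)) (?chi {} F * Q F) =
          rev_poly (?r F) (?chi {} F) * rev_poly (rk M - ?r F) (Q F)"
        using degree_interval_poly[OF M(1), of "{}" F] degQ[OF F] M by (intro rev_poly_mult) auto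
      then show "rev_poly (rk M) (?chi {} F * Q F) = ?b F * rev_poly (rk M - ?r F) (Q F)"
        using rle[of F] F M by simp
    qed
    also have "\<dots> = (\<Sum>F\<in>?L - {{}}. \<Sum>G\<in>{G\<in>?L. F \<subseteq> G}. ?b F * ?chi F G * Q G)"
      by (intro sum.cong refl) (simp add: revQ sum_distrib_left mult.assoc)
    also have "\<dots> = (\<Sum>(F, G)\<in>(SIGMA F:?L - {{}}. {G\<in>?L. F \<subseteq> G}). ?b F * ?chi F G * Q G)"
      using fL by (simp add: sum.Sigma)
    also have "\<dots> = (\<Sum>(G, F)\<in>(SIGMA G:?L - {{}}. {F\<in>?L. F \<subseteq> G} - {{}}). ?b F * ?chi F G * Q G)"
      by (rule sum.reindex_bij_witness[where i = "\<lambda>(G, F). (F, G)" and j = "\<lambda>(F, G). (G, F)"]) auto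
    also have "\<dots> = (\<Sum>G\<in>?L - {{}}. \<Sum>F\<in>{F\<in>?L. F \<subseteq> G} - {{}}. ?b F * ?chi F G * Q G)"
      using fL by (simp add: sum.Sigma)
    also have "\<dots> = (\<Sum>G\<in>?L - {{}}. - (?chi {} G * Q G))"
    proof (rule sum.cong[OF refl])
      fix G assume G: "G \<in> ?L - {{}}"
      let ?S = "{F\<in>?L. F \<subseteq> G}"
      have "(\<Sum>F\<in>?S. ?b F * ?chi F G) = 0"
        using interval_poly_kernel[OF M(1) empty_flat[OF M], of G] G by auto
      moreover have "(\<Sum>F\<in>?S. ?b F * ?chi F G) =
          ?b {} * ?chi {} G + (\<Sum>F\<in>?S - {{}}. ?b F * ?chi F G)"
        using fL empty_flat[OF M] by (intro sum.remove) auto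
      moreover have "?b {} = 1"
        by (simp add: interval_poly_self[OF empty_flat[OF M]] rev_poly_def)
      ultimately have "(\<Sum>F\<in>?S - {{}}. ?b F * ?chi F G) = - ?chi {} G"
        by (simp add: eq_neg_iff_add_eq_0 add.commute)
      then show "(\<Sum>F\<in>?S - {{}}. ?b F * ?chi F G * Q G) = - (?chi {} G * Q G)"
        by (simp add: sum_distrib_right[symmetric])
    qed
    finally show ?thesis by (simp add: R_def sum_negf)
  qed
  have split: "(\<Sum>F\<in>?L. characteristic_poly (restriction M F) * kl_rec (contraction M F)) = kl_rec M + R"
    unfolding kl_sum_split[OF M] R_def Q_def ..
  show ?case
  proof (cases "rk M = 0")
    case True
    have "ground M = {}"
    proof (rule ccontr)
      assume "ground M \<noteq> {}"
      then obtain x where "{x} \<in> indeps M" "{x} \<subseteq> ground M" using M(2) by (auto simp: loopless_def)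
      from card_le_mrank[OF M(1) this] show False using True by simp
    qed
    then have "?L - {{}} = {}" by (auto simp: flats_def)
    then have "R = 0" unfolding R_def by (simp only: sum.empty)
    moreover have "kl_rec M = 1" using True by (subst kl_rec.simps) simp
    ultimately show ?thesis using True split by (simp add: rev_poly_def)
  next
    case False
    let ?n = "rk M"
    have p: "kl_rec M = (\<Sum>i\<in>{i. 2 * i < ?n}. monom (coeff R (?n - i)) i)"
      using False M by (subst kl_rec.simps) (simp add: R_def Q_def)
    have fin: "finite {i. 2 * i < ?n}" by (rule finite_subset[of _ "{..?n}"]) auto
    have cp: "coeff (kl_rec M) k = (if 2 * k < ?n then coeff R (?n - k) else 0)" for k
      unfolding p coeff_sum using fin by simp
    have cR: "(if k \<le> ?n then coeff R (?n - k) else 0) = - coeff R k" for k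
      using arg_cong[OF revR, of "\<lambda>p. coeff p k"] by (simp add: coeff_rev_poly)
    have "2 * degree (kl_rec M) < ?n"
    proof (rule ccontr)
      assume neg: "\<not> ?thesis"
      then have "coeff (kl_rec M) (degree (kl_rec M)) = 0" using cp by simp
      then have "kl_rec M = 0" by simp
      then show False using neg False by simp
    qed
    moreover have "rev_poly ?n (kl_rec M) = kl_rec M + R"
    proof (rule poly_eqI)
      fix k
      consider "k > ?n" | "k \<le> ?n" "2 * k < ?n" | "k \<le> ?n" "2 * k = ?n" | "k \<le> ?n" "2 * k > ?n"
        by linarith
      then show "coeff (rev_poly ?n (kl_rec M)) k = coeff (kl_rec M + R) k"
      proof cases
        case 3
        then have "?n - k = k" by simp
        then show ?thesis using 3 cR[of k] by (simp add: coeff_rev_poly cp)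
      qed (use cR[of k] in \<open>auto simp: coeff_rev_poly cp\<close>)
    qed
    ultimately show ?thesis using False split by simp
  qed
qed

theorem kl_assignment_exists: "\<exists>P :: 'a matroid \<Rightarrow> int poly. kl_assignment P"
  using kl_rec_correct unfolding kl_assignment_def by blast

theorem kl_poly_eq:
  assumes "kl_assignment P" "is_matroid M" "loopless M"
  shows "kl_poly M = P M"
  unfolding kl_poly_def using assms kl_assignment_unique by (intro the_equality) blast+

theorem kl_assignment_kl_poly: "kl_assignment (kl_poly :: 'a matroid \<Rightarrow> int poly)"
proof -
  obtain P :: "'a matroid \<Rightarrow> int poly" where P: "kl_assignment P"
    using kl_assignment_exists by blast
  have eq: "kl_poly M = P M" if "is_matroid M" "loopless M" for M
    using kl_poly_eq[OF P that] .
  have "kl_poly (contraction M F) = P (contraction M F)" if "is_matroid M" "F \<in> flats M" for M F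
    using eq is_matroid_contraction loopless_contraction that by blast
  then show ?thesis using P eq unfolding kl_assignment_def by simp
qed

lemma uniform_matroid_loopless:
  assumes "finite E" "d \<ge> 1"
  shows "is_matroid (uniform_matroid E d)" "loopless (uniform_matroid E d)"
proof -
  have aug: "\<exists>x\<in>J - I. insert x I \<subseteq> E \<and> card (insert x I) \<le> d"
    if "I \<subseteq> E" "J \<subseteq> E" "card J \<le> d" "card I < card J" for I J
  proof -
    have fin: "finite I" "finite J" using that assms finite_subset by auto
    then have "\<not> J \<subseteq> I" using that card_mono[of I J] by auto
    then obtain x where "x \<in> J - I" by auto
    then show ?thesis using that fin by (intro bexI[of _ x]) auto
  qed
  have her: "card J \<le> d" if "I \<subseteq> E" "card I \<le> d" "J \<subseteq> I" for I J
    using that assms by (meson card_mono finite_subset le_trans)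
  show "is_matroid (uniform_matroid E d)"
    unfolding is_matroid_def uniform_matroid_def matroid.sel
  proof (intro conjI ballI allI impI)
    let ?C = "{I. I \<subseteq> E \<and> card I \<le> d}"
    show "J \<in> ?C" if "I \<in> ?C" "J \<subseteq> I" for I J using her that by blast
    show "\<exists>x\<in>J - I. insert x I \<in> ?C" if "I \<in> ?C" "J \<in> ?C" "card I < card J" for I J
      using aug[of I J] that by blast
  qed (use assms in auto)
  show "loopless (uniform_matroid E d)" using assms by (auto simp: loopless_def uniform_matroid_def)
qed
end

theory Submission
  imports Defs
begin

text \<open>For every loopless matroid the polynomial $Z_M(t) = \sum_F t^{\mathrm{rk} F} P_{M^F}(t)$ is
  palindromic of degree $\mathrm{rk} M$. For $U_{m,d}$ all contractions by proper flats are uniform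
  with the same $m$, and $P$ is determined, inductively on $d$, by its degree bound and the
  palindromicity of $Z$. Inserting the claimed coefficients, Vandermonde's identity
  gives the coefficient of $t^q$ in $Z$, with $q + r = d$ and $r \geq 1$, as
  $$\frac{(m+d)!\, d!\, (m-1)!}{q!\,(m+q)!\,r!\,(m+r)!}\,
    [x^{m-1} y^{m-1}] \frac{(1+x)^{m+q} (1+y)^{m+r}}{(1+x+y)^2},$$
  which is symmetric in $q$ and $r$.\<close>

section \<open>Palindromicity of the Z-polynomial\<close>

definition zpoly :: "'a matroid \<Rightarrow> int poly" where
  "zpoly M = (\<Sum>F\<in>flats M. monom 1 (mrank M F) * kl_poly (contraction M F))"

lemma rk_contraction:
  assumes "is_matroid M" "F \<subseteq> ground M"
  shows "rk (contraction M F) = rk M - mrank M F"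
proof -
  have "ground M - F \<union> F = ground M" using assms by auto
  then show ?thesis using mrank_contraction[OF assms(1), of "ground M - F" F] by simp
qed

lemma degree_kl_poly_le:
  assumes "is_matroid M" "loopless M"
  shows "degree (kl_poly M) \<le> rk M"
  using kl_assignment_kl_poly assms unfolding kl_assignment_def
  by (cases "rk M = 0") fastforce+

text \<open>The defining recursion of the contraction by \<open>F\<close>, carried back to
  \<open>M\<close>: its flats are \<open>G - F\<close> for flats \<open>G\<close> above
  \<open>F\<close>, contracting once more gives the contraction by \<open>G\<close>, and the
  localization has the characteristic polynomial of the interval from \<open>F\<close> to
  \<open>G\<close>.\<close>

lemma rev_kl_poly_contraction:
  assumes M: "is_matroid M" and F: "F \<in> flats M"
  shows "rev_poly (rk M - mrank M F) (kl_poly (contraction M F)) =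
    (\<Sum>G\<in>{G\<in>flats M. F \<subseteq> G}. interval_poly M F G * kl_poly (contraction M G))"
proof -
  let ?N = "contraction M F"
  have sub: "F \<subseteq> ground M" using F by (auto simp: flats_def)
  have inj: "inj_on (\<lambda>H. H - F) {G \<in> flats M. F \<subseteq> G}" by (intro inj_onI) blast
  have "rev_poly (rk M - mrank M F) (kl_poly ?N) =
      (\<Sum>K\<in>flats ?N. characteristic_poly (restriction ?N K) * kl_poly (contraction ?N K))"
    using kl_assignment_kl_poly is_matroid_contraction[OF M, of F] loopless_contraction[OF M F]
      rk_contraction[OF M sub]
    unfolding kl_assignment_def by auto
  also have "\<dots> = (\<Sum>G\<in>{G\<in>flats M. F \<subseteq> G}.
      characteristic_poly (restriction ?N (G - F)) * kl_poly (contraction ?N (G - F)))"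
    unfolding flats_contraction[OF M sub] using inj by (simp add: sum.reindex)
  also have "\<dots> = (\<Sum>G\<in>{G\<in>flats M. F \<subseteq> G}. interval_poly M F G * kl_poly (contraction M G))"
  proof (rule sum.cong[OF refl])
    fix G assume G: "G \<in> {G\<in>flats M. F \<subseteq> G}"
    then have "contraction ?N (G - F) = contraction M G"
      by (intro contraction_contraction[OF M]) (auto simp: flats_def)
    then show "characteristic_poly (restriction ?N (G - F)) * kl_poly (contraction ?N (G - F)) =
        interval_poly M F G * kl_poly (contraction M G)"
      using characteristic_poly_interval[OF M, of F G] F G by simp
  qed
  finally show ?thesis .
qed

text \<open>After exchanging the sums over \<open>F\<close> and \<open>H\<close>, the inner sum of
  Moebius values \<open>mobius ?L F H\<close> over all \<open>F\<close> below \<open>H\<close>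
  vanishes unless \<open>H\<close> is the least flat \<open>{}\<close>.\<close>

lemma sum_interval_poly:
  assumes M: "is_matroid M" "loopless M" and G: "G \<in> flats M"
  shows "(\<Sum>F\<in>{F\<in>flats M. F \<subseteq> G}. interval_poly M F G) = monom 1 (mrank M G)"
proof -
  let ?L = "flats M"
  let ?t = "\<lambda>F H. monom (mobius ?L F H) (mrank M G - mrank M H)"
  have fL: "finite ?L" using finite_flats[OF M(1)] .
  have fE: "finite (ground M)" using M by (simp add: is_matroid_def)
  have LE: "?L \<subseteq> Pow (ground M)" by (auto simp: flats_def)
  have "(\<Sum>F\<in>{F\<in>?L. F \<subseteq> G}. interval_poly M F G) =
      (\<Sum>(F, H)\<in>(SIGMA F:{F\<in>?L. F \<subseteq> G}. {H\<in>?L. F \<subseteq> H \<and> H \<subseteq> G}). ?t F H)"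
    unfolding interval_poly_def using fL by (simp add: sum.Sigma)
  \<comment> \<open>The trivial condition \<open>{} \<subseteq> F\<close> gives the inner index set
    the shape of an interval starting at \<open>{}\<close>, as in
    \<open>sum_mobius_dual\<close>.\<close>
  also have "\<dots> = (\<Sum>(H, F)\<in>(SIGMA H:{H\<in>?L. H \<subseteq> G}. {F\<in>?L. {} \<subseteq> F \<and> F \<subseteq> H}). ?t F H)"
    by (rule sum.reindex_bij_witness[where i = "\<lambda>(H, F). (F, H)" and j = "\<lambda>(F, H). (H, F)"]) auto
  also have "\<dots> = (\<Sum>H\<in>{H\<in>?L. H \<subseteq> G}. \<Sum>F\<in>{F\<in>?L. {} \<subseteq> F \<and> F \<subseteq> H}. ?t F H)"
    using fL by (simp add: sum.Sigma)
  also have "\<dots> = (\<Sum>H\<in>{H\<in>?L. H \<subseteq> G}. if H = {} then monom 1 (mrank M G) else 0)"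
  proof (rule sum.cong[OF refl])
    fix H assume H: "H \<in> {H\<in>?L. H \<subseteq> G}"
    have "(\<Sum>F\<in>{F\<in>?L. {} \<subseteq> F \<and> F \<subseteq> H}. ?t F H) =
        monom (\<Sum>F\<in>{F\<in>?L. {} \<subseteq> F \<and> F \<subseteq> H}. mobius ?L F H) (mrank M G - mrank M H)"
      by (intro poly_eqI) (simp add: coeff_sum)
    also have "(\<Sum>F\<in>{F\<in>?L. {} \<subseteq> F \<and> F \<subseteq> H}. mobius ?L F H) = (if {} = H then 1 else 0)"
      using H fL fE LE empty_flat[OF M] by (intro sum_mobius_dual) auto
    finally show "(\<Sum>F\<in>{F\<in>?L. {} \<subseteq> F \<and> F \<subseteq> H}. ?t F H) =
        (if H = {} then monom 1 (mrank M G) else 0)"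
      using M by auto
  qed
  also have "\<dots> = monom 1 (mrank M G)"
    using fL empty_flat[OF M] by simp
  finally show ?thesis .
qed

text \<open>Reversal cancels the factor of degree \<open>mrank M F\<close> and reverses the
  Kazhdan-Lusztig polynomial of the contraction. Expanding that by the recursion and summing over
  \<open>F\<close> first, \<open>sum_interval_poly\<close> restores the monomial of each flat
  \<open>G\<close>.\<close>

theorem rev_zpoly:
  assumes M: "is_matroid M" "loopless M"
  shows "rev_poly (rk M) (zpoly M) = zpoly M"
proof -
  let ?L = "flats M" and ?P = "\<lambda>F. kl_poly (contraction M F)"
  have fL: "finite ?L" using finite_flats[OF M(1)] .
  have "rev_poly (rk M) (zpoly M) = (\<Sum>F\<in>?L. rev_poly (rk M - mrank M F) (?P F))"
    unfolding zpoly_def rev_poly_sum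
  proof (rule sum.cong[OF refl])
    fix F assume F: "F \<in> ?L"
    then have sub: "F \<subseteq> ground M" by (auto simp: flats_def)
    have "degree (?P F) \<le> rk M - mrank M F"
      using degree_kl_poly_le[OF is_matroid_contraction[OF M(1)] loopless_contraction[OF M(1) F]]
        rk_contraction[OF M(1) sub] by simp
    then have "rev_poly (mrank M F + (rk M - mrank M F)) (monom 1 (mrank M F) * ?P F) =
        rev_poly (mrank M F) (monom 1 (mrank M F)) * rev_poly (rk M - mrank M F) (?P F)"
      by (intro rev_poly_mult) (auto intro: degree_monom_le)
    then show "rev_poly (rk M) (monom 1 (mrank M F) * ?P F) = rev_poly (rk M - mrank M F) (?P F)"
      using mrank_mono[OF M(1) sub] by (simp add: rev_poly_monom)
  qed
  also have "\<dots> = (\<Sum>F\<in>?L. \<Sum>G\<in>{G\<in>?L. F \<subseteq> G}. interval_poly M F G * ?P G)"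
    by (intro sum.cong refl rev_kl_poly_contraction[OF M(1)])
  also have "\<dots> = (\<Sum>(F, G)\<in>(SIGMA F:?L. {G\<in>?L. F \<subseteq> G}). interval_poly M F G * ?P G)"
    using fL by (simp add: sum.Sigma)
  also have "\<dots> = (\<Sum>(G, F)\<in>(SIGMA G:?L. {F\<in>?L. F \<subseteq> G}). interval_poly M F G * ?P G)"
    by (rule sum.reindex_bij_witness[where i = "\<lambda>(G, F). (F, G)" and j = "\<lambda>(F, G). (G, F)"]) auto
  also have "\<dots> = (\<Sum>G\<in>?L. \<Sum>F\<in>{F\<in>?L. F \<subseteq> G}. interval_poly M F G * ?P G)"
    using fL by (simp add: sum.Sigma)
  also have "\<dots> = zpoly M"
    unfolding zpoly_def
    by (intro sum.cong refl) (simp add: sum_distrib_right[symmetric] sum_interval_poly[OF M])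
  finally show ?thesis .
qed

section \<open>Rank, flats and contractions of uniform matroids\<close>

lemma mrank_uniform_matroid:
  assumes "finite E" "A \<subseteq> E"
  shows "mrank (uniform_matroid E d) A = min (card A) d"
  unfolding mrank_def
proof (rule Max_eqI)
  let ?S = "{I \<in> indeps (uniform_matroid E d). I \<subseteq> A}"
  have fA: "finite A" using assms finite_subset by blast
  then show "finite (card ` ?S)" by simp
  show "y \<le> min (card A) d" if "y \<in> card ` ?S" for y
    using that fA by (auto simp: uniform_matroid_def card_mono)
  obtain I where "I \<subseteq> A" "card I = min (card A) d"
    by (meson min.cobounded1 obtain_subset_with_card_n)
  then show "min (card A) d \<in> card ` ?S"
    using assms by (intro image_eqI[of _ _ I]) (auto simp: uniform_matroid_def)
qed

lemma flats_uniform_matroid: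
  assumes E: "finite E" "d \<le> card E"
  shows "flats (uniform_matroid E d) = insert E {F. F \<subseteq> E \<and> card F < d}"
proof -
  have "F \<in> flats (uniform_matroid E d) \<longleftrightarrow> F = E \<or> card F < d" if F: "F \<subseteq> E" for F
  proof -
    have fF: "finite F" using F E finite_subset by blast
    have "mrank (uniform_matroid E d) F < mrank (uniform_matroid E d) (insert x F) \<longleftrightarrow> card F < d"
      if "x \<in> E - F" for x
      using that F fF E by (auto simp: mrank_uniform_matroid)
    then show ?thesis
      using F by (auto simp: flats_def uniform_matroid_def)
  qed
  moreover have "F \<subseteq> E" if "F \<in> flats (uniform_matroid E d)" for F
    using that by (auto simp: flats_def uniform_matroid_def)
  ultimately show ?thesis by auto
qed

text \<open>Ground set size and rank drop by the same amount, so \<open>m\<close>, their difference,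
  is kept; this allows an induction on \<open>d\<close> with \<open>m\<close> fixed.\<close>

lemma contraction_uniform_matroid:
  assumes E: "finite E" and F: "F \<subseteq> E" "card F \<le> d"
  shows "contraction (uniform_matroid E d) F = uniform_matroid (E - F) (d - card F)"
proof -
  have "mrank (uniform_matroid E d) (I \<union> F) = card I + mrank (uniform_matroid E d) F \<longleftrightarrow>
      card I \<le> d - card F" if I: "I \<subseteq> E - F" for I
  proof -
    have fin: "finite I" "finite F" using I E F by (auto intro: finite_subset)
    have "I \<inter> F = {}" "I \<union> F \<subseteq> E" using I F by auto
    then show ?thesis
      using fin E F by (auto simp: mrank_uniform_matroid card_Un_disjoint)
  qed
  then show ?thesis by (auto simp: contraction_def uniform_matroid_def)
qed

lemma sum_subsets_by_card:
  fixes g :: "nat \<Rightarrow> 'b :: comm_semiring_1"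
  assumes "finite E"
  shows "(\<Sum>F\<in>{F. F \<subseteq> E \<and> card F < d}. g (card F)) = (\<Sum>j<d. of_nat (card E choose j) * g j)"
proof -
  let ?S = "{F. F \<subseteq> E \<and> card F < d}"
  have "(\<Sum>F\<in>?S. g (card F)) = (\<Sum>j<d. \<Sum>F\<in>{F\<in>?S. card F = j}. g (card F))"
    using assms by (intro sum.group[symmetric]) auto
  also have "\<dots> = (\<Sum>j<d. of_nat (card E choose j) * g j)"
  proof (rule sum.cong[OF refl])
    fix j assume "j \<in> {..<d}"
    then have "{F\<in>?S. card F = j} = {F. F \<subseteq> E \<and> card F = j}" by auto
    then show "(\<Sum>F\<in>{F\<in>?S. card F = j}. g (card F)) = of_nat (card E choose j) * g j"
      using n_subsets[OF assms, of j] by simp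
  qed
  finally show ?thesis .
qed

section \<open>A symmetric family of generating function coefficients\<close>

text \<open>The coefficient of $x^M y^N$ in $(1 + x)^a (1 + y)^b / (1 + x + y)^2$, obtained by expanding
  in powers of \<open>x\<close> first; expanding in \<open>y\<close> first gives the symmetry.\<close>

definition sym_coeff :: "real \<Rightarrow> real \<Rightarrow> nat \<Rightarrow> nat \<Rightarrow> real" where
  "sym_coeff a b M N =
     (\<Sum>h\<le>M. (- 1) ^ h * real (Suc h) * (a gchoose (M - h)) * ((b - real h - 2) gchoose N))"

text \<open>Here and in the next three lemmas: raising \<open>a\<close> or \<open>b\<close> by one
  multiplies the generating function by 1 + x or 1 + y. A coefficient thus gains its lower neighbour
  in that variable, if there is one. On the sums this is Pascal's rule term by term.\<close>

lemma sym_coeff_left_0: "sym_coeff (a + 1) b 0 N = sym_coeff a b 0 N"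
  by (simp add: sym_coeff_def)

lemma sym_coeff_left_Suc:
  "sym_coeff (a + 1) b (Suc M) N = sym_coeff a b (Suc M) N + sym_coeff a b M N"
proof -
  define c where "c h = (- 1) ^ h * real (Suc h)" for h
  define g where "g h = ((b - real h - 2) gchoose N)" for h
  have exp: "sym_coeff x b K N = (\<Sum>h\<le>K. c h * (x gchoose (K - h)) * g h)" for x K
    by (simp add: sym_coeff_def c_def g_def)
  \<comment> \<open>The summand at \<open>h = Suc M\<close> has \<open>gchoose 0\<close> on both
    sides and does not change, so only \<open>h \<le> M\<close> is treated.\<close>
  have "(\<Sum>h\<le>M. c h * ((a + 1) gchoose (Suc M - h)) * g h) =
      (\<Sum>h\<le>M. c h * (a gchoose (Suc M - h)) * g h) + (\<Sum>h\<le>M. c h * (a gchoose (M - h)) * g h)"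
    unfolding sum.distrib[symmetric]
    by (intro sum.cong refl) (simp add: Suc_diff_le gbinomial_Suc_Suc distrib_left distrib_right)
  then show ?thesis by (simp add: exp)
qed

lemma sym_coeff_right_0: "sym_coeff a (b + 1) M 0 = sym_coeff a b M 0"
  by (simp add: sym_coeff_def)

lemma sym_coeff_right_Suc:
  "sym_coeff a (b + 1) M (Suc N) = sym_coeff a b M (Suc N) + sym_coeff a b M N"
proof -
  have "((b + 1 - real h - 2) gchoose Suc N) =
      ((b - real h - 2) gchoose Suc N) + ((b - real h - 2) gchoose N)" for h
    using gbinomial_Suc_Suc[of "b - real h - 2" N] by (simp add: algebra_simps)
  then show ?thesis by (simp add: sym_coeff_def distrib_left sum.distrib)
qed

text \<open>Only the summand \<open>h = M\<close> survives. The resulting coefficient of 1/(1 + x +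
  y)^2 is visibly symmetric.\<close>

lemma sym_coeff_0_0: "sym_coeff 0 0 M N = (- 1) ^ (M + N) * fact (M + N + 1) / (fact M * fact N)"
proof -
  have "sym_coeff 0 0 M N =
      (\<Sum>h\<le>M. if h = M then (- 1) ^ M * real (Suc M) * ((- real M - 2) gchoose N) else 0)"
    unfolding sym_coeff_def by (intro sum.cong refl) (auto simp: gbinomial_0_left)
  also have "\<dots> = (- 1) ^ M * real (Suc M) * ((- real (M + 2)) gchoose N)"
    by (simp add: algebra_simps)
  also have "(- real (M + 2)) gchoose N = (- 1) ^ N * ((real (M + 2) + real N - 1) gchoose N)"
    by (rule gbinomial_minus)
  also have "real (M + 2) + real N - 1 = real (M + N + 1)" by simp
  also have "real (M + N + 1) gchoose N = fact (M + N + 1) / (fact N * fact (Suc M))"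
    by (simp only: binomial_gbinomial[symmetric]) (simp add: binomial_fact Suc_diff_le)
  also have "(- 1) ^ M * real (Suc M) * ((- 1) ^ N * (fact (M + N + 1) / (fact N * fact (Suc M)))) =
      (- 1) ^ (M + N) * fact (M + N + 1) * (real (Suc M) / fact (Suc M)) / fact N"
    by (simp add: power_add mult_ac)
  also have "real (Suc M) / fact (Suc M) = 1 / fact M" by simp
  finally show ?thesis by (simp add: power_add mult_ac)
qed

text \<open>Both sides obey the same recursions in \<open>a\<close> and \<open>b\<close> and agree
  at \<open>a = b = 0\<close>.\<close>

lemma sym_coeff_commute: "sym_coeff (real a) (real b) M N = sym_coeff (real b) (real a) N M"
proof (induction a arbitrary: M N)
  case 0
  show ?case
  proof (induction b arbitrary: M N)
    case 0
    show ?case by (simp add: sym_coeff_0_0 add_ac mult_ac)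
  next
    case (Suc b)
    then show ?case
      by (cases N) (simp_all add: sym_coeff_left_0 sym_coeff_left_Suc sym_coeff_right_0
          sym_coeff_right_Suc add.commute[of 1])
  qed
next
  case (Suc a)
  then show ?case
    by (cases M) (simp_all add: sym_coeff_left_0 sym_coeff_left_Suc sym_coeff_right_0
        sym_coeff_right_Suc add.commute[of 1])
qed

text \<open>By Pascal's rule, an alternating binomial sum is an iterated difference: one more step
  replaces \<open>f h\<close> by \<open>f h - f (Suc h)\<close>.\<close>

lemma sum_alternating_binomial_Suc:
  fixes f :: "nat \<Rightarrow> 'a :: comm_ring_1"
  shows "(\<Sum>h\<le>Suc M. (- 1) ^ h * of_nat (Suc M choose h) * f h) =
    (\<Sum>h\<le>M. (- 1) ^ h * of_nat (M choose h) * f h) -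
    (\<Sum>h\<le>M. (- 1) ^ h * of_nat (M choose h) * f (Suc h))"
proof -
  have "(\<Sum>h\<le>M. (- 1) ^ h * of_nat (M choose h) * f h) =
      (\<Sum>h\<le>Suc M. (- 1) ^ h * of_nat (M choose h) * f h)"
    by (simp add: binomial_eq_0)
  also have "\<dots> = f 0 + (\<Sum>h\<le>M. (- 1) ^ Suc h * of_nat (M choose Suc h) * f (Suc h))"
    unfolding sum.atMost_Suc_shift by simp
  finally have *: "(\<Sum>h\<le>M. (- 1) ^ h * of_nat (M choose h) * f h) = \<dots>" .
  have "(\<Sum>h\<le>Suc M. (- 1) ^ h * of_nat (Suc M choose h) * f h) =
      f 0 + (\<Sum>h\<le>M. (- 1) ^ Suc h * of_nat (Suc M choose Suc h) * f (Suc h))"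
    unfolding sum.atMost_Suc_shift by simp
  also have "(\<Sum>h\<le>M. (- 1) ^ Suc h * of_nat (Suc M choose Suc h) * f (Suc h)) =
      (\<Sum>h\<le>M. (- 1) ^ Suc h * of_nat (M choose Suc h) * f (Suc h)) -
      (\<Sum>h\<le>M. (- 1) ^ h * of_nat (M choose h) * f (Suc h))"
    unfolding sum_subtractf[symmetric] by (intro sum.cong refl) (simp add: algebra_simps)
  finally show ?thesis unfolding * by simp
qed

text \<open>The left side is an \<open>M\<close>-fold backward difference in \<open>x\<close>, and
  each difference lowers the lower index of \<open>gchoose\<close> and \<open>x\<close> by
  one.\<close>

lemma sum_alternating_gbinomial:
  fixes x :: real
  shows "(\<Sum>h\<le>M. (- 1) ^ h * real (M choose h) * ((x - real h) gchoose (M + N))) =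
    ((x - real M) gchoose N)"
proof (induction M arbitrary: x N)
  case (Suc M)
  let ?g = "\<lambda>x h. (- 1) ^ h * real (M choose h) * ((x - real h) gchoose (M + Suc N))"
  have "(\<Sum>h\<le>Suc M. (- 1) ^ h * real (Suc M choose h) * ((x - real h) gchoose (Suc M + N))) =
      (\<Sum>h\<le>M. ?g x h) - (\<Sum>h\<le>M. ?g (x - 1) h)"
    unfolding sum_alternating_binomial_Suc by (simp add: algebra_simps)
  also have "(\<Sum>h\<le>M. ?g x h) = ((x - real M) gchoose Suc N)" by (rule Suc.IH)
  also have "(\<Sum>h\<le>M. ?g (x - 1) h) = ((x - 1 - real M) gchoose Suc N)" by (rule Suc.IH)
  also have "((x - real M) gchoose Suc N) =
      ((x - 1 - real M) gchoose N) + ((x - 1 - real M) gchoose Suc N)"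
    using gbinomial_Suc_Suc[of "x - 1 - real M" N] by (simp add: algebra_simps)
  finally show ?case by (simp add: algebra_simps)
qed simp

text \<open>Absorption turns \<open>Suc h\<close> times the first binomial into \<open>m\<close>
  times \<open>M choose h\<close>, where \<open>m = Suc M\<close>. What remains is the iterated
  difference above with \<open>N = 0\<close>, which equals 1 whatever \<open>b\<close> is.\<close>

lemma sym_coeff_diagonal:
  assumes "m \<ge> 1"
  shows "sym_coeff (real m) b (m - 1) (m - 1) = real m"
proof -
  obtain M where m: "m = Suc M" using assms by (cases m) auto
  have absorb: "real (Suc h) * (real m gchoose (M - h)) = real m * real (M choose h)" if "h \<le> M" for h
  proof -
    have "Suc M choose (M - h) = Suc M choose Suc h"
      using binomial_symmetric[of "M - h" "Suc M"] that by (simp add: Suc_diff_le)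
    then have "real m gchoose (M - h) = real (Suc M choose Suc h)"
      unfolding m by (metis binomial_gbinomial)
    then show ?thesis
      using Suc_times_binomial[of h M] m by (metis of_nat_mult)
  qed
  have "sym_coeff (real m) b M M =
      (\<Sum>h\<le>M. real m * ((- 1) ^ h * real (M choose h) * ((b - 2 - real h) gchoose (M + 0))))"
    unfolding sym_coeff_def
  proof (rule sum.cong[OF refl])
    fix h assume "h \<in> {..M}"
    then have "real (Suc h) * (real m gchoose (M - h)) = real m * real (M choose h)"
      using absorb by simp
    moreover have "b - real h - 2 = b - 2 - real h" by simp
    ultimately show "(- 1) ^ h * real (Suc h) * (real m gchoose (M - h)) * ((b - real h - 2) gchoose M) =
        real m * ((- 1) ^ h * real (M choose h) * ((b - 2 - real h) gchoose (M + 0)))"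
      by (simp only: mult.assoc mult.left_commute add_0_right)
  qed
  also have "\<dots> = real m" unfolding sum_distrib_left[symmetric] sum_alternating_gbinomial by simp
  finally show ?thesis by (simp add: m)
qed

section \<open>The claimed coefficients and their binomial sums\<close>

text \<open>The claimed coefficient divided by $\binom{m+d}{k}$, as a function of \<open>r = d - k\<close> and with the
  summation index \<open>h\<close> lowered by one. It vanishes for \<open>r \<le> k\<close>, so no degree condition is needed.\<close>

definition skew_number :: "nat \<Rightarrow> nat \<Rightarrow> nat \<Rightarrow> real" where
  "skew_number m k r = (\<Sum>h<m. (- 1) ^ h * real (Suc h) * real (r choose (k + Suc h)) *
     real ((r - 1 + (m - 1 - h)) choose (r - 1))) / real r"

definition uniform_coeff :: "nat \<Rightarrow> nat \<Rightarrow> nat \<Rightarrow> real" where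
  "uniform_coeff m d i = real ((m + d) choose i) * skew_number m i (d - i)"

lemma uniform_coeff_eq_0: "d \<le> 2 * i \<Longrightarrow> uniform_coeff m d i = 0"
  by (simp add: uniform_coeff_def skew_number_def binomial_eq_0)

text \<open>Vandermonde's identity after the reflection of \<open>k\<close> to \<open>q - k\<close>;
  the summands added up to \<open>q + h\<close> are zero.\<close>

lemma sum_binomial_shift:
  "(\<Sum>k\<le>q. (q choose k) * (r choose (k + h))) = (q + r) choose (q + h)"
proof -
  have "(\<Sum>k\<le>q. (q choose k) * (r choose (k + h))) = (\<Sum>k\<le>q. (q choose k) * (r choose (q + h - k)))"
    by (rule sum.reindex_bij_witness[where i = "\<lambda>k. q - k" and j = "\<lambda>k. q - k"])
       (auto simp: binomial_symmetric[symmetric] add.commute)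
  also have "\<dots> = (\<Sum>k\<le>q + h. (q choose k) * (r choose (q + h - k)))"
    by (rule sum.mono_neutral_left) (auto simp: binomial_eq_0)
  finally show ?thesis by (simp add: vandermonde)
qed

text \<open>Splits off a factor free of \<open>h\<close>, leaving the two binomials of a summand of
  \<open>sym_coeff\<close>. With \<open>u = m - 1 - h\<close> and \<open>v = r - 1 - h\<close> it is
  a factorial identity; for \<open>h \<ge> r\<close> both sides are zero.\<close>

lemma binomial_product_rearrange:
  assumes "r \<ge> 1" "h < m"
  shows "real ((q + r) choose (q + Suc h)) * real ((r - 1 + (m - 1 - h)) choose (r - 1)) / real r =
    fact (q + r) * fact (m - 1) / (fact (m + q) * fact r) *
      (real ((m + q) choose (m - 1 - h)) * real ((r - 1 + (m - 1 - h)) choose (m - 1)))"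
proof -
  obtain u where m: "m = Suc (h + u)" using assms(2) less_iff_Suc_add by auto
  show ?thesis
  proof (cases "Suc h \<le> r")
    case True
    then obtain v where r: "r = Suc (h + v)" by (metis add_Suc le_Suc_ex)
    have 1: "real ((q + r) choose (q + Suc h)) = fact (q + r) / (fact (q + Suc h) * fact v)"
      by (subst binomial_fact) (simp_all add: r)
    have 2: "real ((h + v + u) choose (h + v)) = fact (h + v + u) / (fact (h + v) * fact u)"
      by (subst binomial_fact) simp_all
    have 3: "real ((m + q) choose u) = fact (m + q) / (fact u * fact (q + Suc h))"
      by (subst binomial_fact) (simp_all add: m add_ac)
    have 4: "real ((h + v + u) choose (h + u)) = fact (h + v + u) / (fact (h + u) * fact v)"
      by (subst binomial_fact) simp_all
    have 5: "fact r = real r * fact (h + v)" by (simp add: r)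
    have 6: "r - 1 = h + v" "m - 1 - h = u" "m - 1 = h + u" by (simp_all add: r m)
    show ?thesis unfolding 6(1,2) unfolding 6(3) 1 2 3 4 5
      using assms by (simp add: divide_simps del: add_Suc_right fact_Suc)
  next
    case False
    then show ?thesis using assms by (simp add: binomial_eq_0 m)
  qed
qed

text \<open>Summing over \<open>k\<close> first, \<open>sum_binomial_shift\<close> removes
  \<open>k\<close>, and the rearrangement above turns the sum over \<open>h\<close> into
  \<open>sym_coeff\<close>.\<close>

lemma sum_skew_number:
  assumes "r \<ge> 1" "m \<ge> 1"
  shows "(\<Sum>k\<le>q. real (q choose k) * skew_number m k r) =
    fact (q + r) * fact (m - 1) / (fact (m + q) * fact r) *
      sym_coeff (real (m + q)) (real (m + r)) (m - 1) (m - 1)"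
proof -
  let ?b = "\<lambda>h. real ((r - 1 + (m - 1 - h)) choose (r - 1))"
  let ?C = "fact (q + r) * fact (m - 1) / (fact (m + q) * fact r) :: real"
  have "(\<Sum>k\<le>q. real (q choose k) * skew_number m k r) =
      (\<Sum>k\<le>q. \<Sum>h<m. (- 1) ^ h * real (Suc h) * ?b h / real r *
        (real (q choose k) * real (r choose (k + Suc h))))"
    unfolding skew_number_def sum_divide_distrib sum_distrib_left
    by (intro sum.cong refl) (simp add: mult_ac)
  also have "\<dots> = (\<Sum>h<m. (- 1) ^ h * real (Suc h) * ?b h / real r *
      real (\<Sum>k\<le>q. (q choose k) * (r choose (k + Suc h))))"
    by (subst sum.swap) (simp add: sum_distrib_left)
  also have "\<dots> = (\<Sum>h<m. (- 1) ^ h * real (Suc h) *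
      (real ((q + r) choose (q + Suc h)) * ?b h / real r))"
    unfolding sum_binomial_shift by (simp add: mult_ac)
  also have "\<dots> = (\<Sum>h<m. ?C * ((- 1) ^ h * real (Suc h) * (real (m + q) gchoose (m - 1 - h)) *
      ((real (m + r) - real h - 2) gchoose (m - 1))))"
  proof (rule sum.cong[OF refl])
    fix h assume "h \<in> {..<m}"
    then have h: "h < m" by simp
    \<comment> \<open>The upper argument in \<open>sym_coeff\<close> is a natural number here, so
      \<open>gchoose\<close> is an ordinary binomial.\<close>
    have "real (m + r) - real h - 2 = real (r - 1 + (m - 1 - h))" using h assms by simp
    then show "(- 1) ^ h * real (Suc h) * (real ((q + r) choose (q + Suc h)) * ?b h / real r) =
        ?C * ((- 1) ^ h * real (Suc h) * (real (m + q) gchoose (m - 1 - h)) *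
          ((real (m + r) - real h - 2) gchoose (m - 1)))"
      unfolding binomial_product_rearrange[OF assms(1) h]
      by (simp only: binomial_gbinomial mult_ac)
  qed
  also have "\<dots> = ?C * sym_coeff (real (m + q)) (real (m + r)) (m - 1) (m - 1)"
  proof -
    have "{..<m} = {..m - 1}" using assms by auto
    then show ?thesis by (simp only: sym_coeff_def sum_distrib_left)
  qed
  finally show ?thesis .
qed

section \<open>The claimed Z-coefficients and their symmetry\<close>

text \<open>The coefficient of t^q in the Z-polynomial of U_{m,d}, provided that
  \<open>uniform_coeff\<close> gives the Kazhdan-Lusztig coefficients: the sum runs over the sizes
  \<open>j\<close> of proper flats, and the last summand belongs to the flat \<open>E\<close>, whose
  contraction has rank 0.\<close>

definition uniform_zcoeff :: "nat \<Rightarrow> nat \<Rightarrow> nat \<Rightarrow> real" where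
  "uniform_zcoeff m d q =
     (\<Sum>j<d. real ((m + d) choose j) * (if j \<le> q then uniform_coeff m (d - j) (q - j) else 0)) +
     (if q = d then 1 else 0)"

lemma uniform_zcoeff_top: "uniform_zcoeff m d d = 1"
proof -
  have "uniform_coeff m (d - j) (d - j) = 0" for j by (rule uniform_coeff_eq_0) simp
  then show ?thesis by (simp add: uniform_zcoeff_def)
qed

text \<open>With \<open>k = q - j\<close>, every summand has the same rank minus index,
  \<open>r\<close>. Hence the product of the two outer binomials is \<open>?n choose q\<close> times
  \<open>q choose k\<close>, and \<open>sum_skew_number\<close> evaluates the rest.\<close>

lemma uniform_zcoeff_eq:
  assumes "m \<ge> 1" "r \<ge> 1"
  shows "uniform_zcoeff m (q + r) q = fact (m + q + r) * fact (q + r) * fact (m - 1) /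
    (fact q * fact (m + q) * (fact r * fact (m + r))) *
      sym_coeff (real (m + q)) (real (m + r)) (m - 1) (m - 1)"
proof -
  let ?n = "m + (q + r)"
  \<comment> \<open>As \<open>r \<ge> 1\<close>, the flat \<open>E\<close> contributes nothing, and
    every \<open>j \<le> q\<close> lies below the rank.\<close>
  have "uniform_zcoeff m (q + r) q = (\<Sum>j\<le>q. real (?n choose j) * uniform_coeff m (q + r - j) (q - j))"
    unfolding uniform_zcoeff_def using assms
    by (simp, intro sum.mono_neutral_cong_right) auto
  also have "\<dots> = (\<Sum>k\<le>q. real (?n choose (q - k)) * uniform_coeff m (r + k) k)"
    by (rule sum.reindex_bij_witness[where i = "\<lambda>k. q - k" and j = "\<lambda>k. q - k"])
       (auto simp: add.commute)
  also have "\<dots> = (\<Sum>k\<le>q. real (?n choose q) * (real (q choose k) * skew_number m k r))"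
  proof (rule sum.cong[OF refl])
    fix k assume "k \<in> {..q}"
    then have k: "k \<le> q" by simp
    \<comment> \<open>Counts the pairs of a \<open>q\<close>-set and a subset of it of size
      \<open>q - k\<close> in two ways.\<close>
    have "(?n choose q) * (q choose (q - k)) = (?n choose (q - k)) * ((?n - (q - k)) choose (q - (q - k)))"
      by (rule choose_mult) auto
    moreover have "?n - (q - k) = m + (r + k)" "q - (q - k) = k" using k by simp_all
    moreover have "q choose (q - k) = q choose k" using binomial_symmetric[OF k] by simp
    ultimately have "(?n choose (q - k)) * ((m + (r + k)) choose k) = (?n choose q) * (q choose k)"
      by simp
    then have "real (?n choose (q - k)) * real ((m + (r + k)) choose k) =
        real (?n choose q) * real (q choose k)"
      by (metis of_nat_mult)
    then show "real (?n choose (q - k)) * uniform_coeff m (r + k) k =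
        real (?n choose q) * (real (q choose k) * skew_number m k r)"
      by (simp add: uniform_coeff_def)
  qed
  also have "\<dots> = real (?n choose q) * (\<Sum>k\<le>q. real (q choose k) * skew_number m k r)"
    by (simp add: sum_distrib_left)
  also have "real (?n choose q) = fact (m + q + r) / (fact q * fact (m + r))"
    by (subst binomial_fact) (simp_all add: add_ac)
  finally show ?thesis unfolding sum_skew_number[OF assms(2,1)] by (simp add: mult_ac)
qed

text \<open>At \<open>q = 0\<close> the factorial prefactor is 1/m, which cancels the value in
  \<open>sym_coeff_diagonal\<close>.\<close>

lemma uniform_zcoeff_bot:
  assumes "m \<ge> 1" "d \<ge> 1"
  shows "uniform_zcoeff m d 0 = 1"
proof -
  have "fact m = real m * fact (m - 1)" using assms by (simp add: fact_reduce)
  then show ?thesis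
    using uniform_zcoeff_eq[OF assms, of 0] sym_coeff_diagonal[OF assms(1), of "real (m + d)"] assms
    by simp
qed

text \<open>For positive \<open>q\<close> and \<open>r\<close> the prefactor is symmetric and
  \<open>sym_coeff_commute\<close> applies. The closed form does not reach the top coefficient, so
  the end pair is compared by its values, both 1.\<close>

lemma uniform_zcoeff_symmetric:
  assumes "m \<ge> 1" "q + r \<ge> 1"
  shows "uniform_zcoeff m (q + r) q = uniform_zcoeff m (q + r) r"
proof -
  consider "q = 0" | "r = 0" | "q \<ge> 1" "r \<ge> 1" by linarith
  then show ?thesis
  proof cases
    case 3
    then show ?thesis
      using uniform_zcoeff_eq[of m r q] uniform_zcoeff_eq[of m q r] assms
        sym_coeff_commute[of "m + q" "m + r"]
      by (simp add: add_ac mult_ac)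
  qed (use assms in \<open>simp_all add: uniform_zcoeff_top uniform_zcoeff_bot\<close>)
qed

section \<open>Induction on the rank\<close>

text \<open>Among the flats, only \<open>{}\<close> has a contraction not known by \<open>IH\<close>
  or by rank 0, namely the matroid itself. So the true and the claimed Z-coefficient differ exactly
  as the Kazhdan-Lusztig coefficients do.\<close>

lemma coeff_zpoly_uniform_matroid:
  assumes m: "m \<ge> 1" and d: "d \<ge> 1" and E: "finite E" "card E = m + d"
    and IH: "\<And>F i. F \<subseteq> E \<Longrightarrow> F \<noteq> {} \<Longrightarrow> card F < d \<Longrightarrow>
      real_of_int (coeff (kl_poly (uniform_matroid (E - F) (d - card F))) i) =
      uniform_coeff m (d - card F) i"
  shows "real_of_int (coeff (zpoly (uniform_matroid E d)) q) =
    real_of_int (coeff (kl_poly (uniform_matroid E d)) q) - uniform_coeff m d q + uniform_zcoeff m d q"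
proof -
  let ?M = "uniform_matroid E d" and ?S = "{F. F \<subseteq> E \<and> card F < d}"
  let ?g = "\<lambda>j. if j \<le> q then uniform_coeff m (d - j) (q - j) else 0"
  let ?f = "\<lambda>F. real_of_int (coeff (monom 1 (mrank ?M F) * kl_poly (contraction ?M F)) q)"
  have M: "is_matroid ?M" "loopless ?M" using uniform_matroid_loopless[OF E(1) d] by auto
  have gr: "ground ?M = E" by (simp add: uniform_matroid_def)
  have fS: "finite ?S" and S0: "{} \<in> ?S" and ES: "E \<notin> ?S" using E d by auto
  have "rk (contraction ?M E) = 0" using rk_contraction[OF M(1), of E] gr by simp
  moreover have "E \<in> flats ?M" using ground_flat[of ?M] gr by simp
  ultimately have "kl_poly (contraction ?M E) = 1"
    using kl_assignment_kl_poly is_matroid_contraction[OF M(1)] loopless_contraction[OF M(1)]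
    unfolding kl_assignment_def by blast
  moreover have "mrank ?M E = d" using E by (simp add: mrank_uniform_matroid)
  ultimately have fE: "?f E = (if q = d then 1 else 0)" by simp
  have f0: "?f {} = real_of_int (coeff (kl_poly ?M) q)"
    using M by (simp add: contraction_empty)
  have f: "?f F = ?g (card F)" if "F \<in> ?S - {{}}" for F
  proof -
    have "mrank ?M F = card F" "contraction ?M F = uniform_matroid (E - F) (d - card F)"
      using that E by (auto simp: mrank_uniform_matroid contraction_uniform_matroid)
    then show ?thesis using that IH[of F "q - card F"] by (auto simp: coeff_monom_mult)
  qed
  have "real_of_int (coeff (zpoly ?M) q) = (\<Sum>F\<in>insert E ?S. ?f F)"
    using flats_uniform_matroid[of E d] E by (simp add: zpoly_def coeff_sum)
  also have "\<dots> = (if q = d then 1 else 0) + (\<Sum>F\<in>?S. ?f F)"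
    using fS ES fE by (simp only: sum.insert not_False_eq_True)
  also have "(\<Sum>F\<in>?S. ?f F) = ?f {} + (\<Sum>F\<in>?S - {{}}. ?f F)"
    by (rule sum.remove[OF fS S0])
  also have "(\<Sum>F\<in>?S - {{}}. ?f F) = (\<Sum>F\<in>?S - {{}}. ?g (card F))"
    by (intro sum.cong refl f)
  \<comment> \<open>The claimed term of \<open>{}\<close> is added and subtracted, which completes
    the sum to one over all sizes below \<open>d\<close>.\<close>
  also have "\<dots> = (\<Sum>F\<in>?S. ?g (card F)) - ?g 0"
    unfolding sum.remove[OF fS S0, of "\<lambda>F. ?g (card F)"] by simp
  also have "(\<Sum>F\<in>?S. ?g (card F)) = (\<Sum>j<d. real ((m + d) choose j) * ?g j)"
    using sum_subsets_by_card[OF E(1), of ?g d] unfolding E(2) .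
  finally show ?thesis unfolding f0 by (simp add: uniform_zcoeff_def)
qed

text \<open>The deviation \<open>?D\<close> is a difference of two palindromic sequences, hence
  takes equal values at \<open>i\<close> and \<open>d - i\<close>. It vanishes from d/2 on by the
  degree bounds, hence everywhere.\<close>

theorem coeff_kl_poly_uniform_matroid:
  assumes m: "m \<ge> 1" and "d \<ge> 1" "finite E" "card E = m + d"
  shows "real_of_int (coeff (kl_poly (uniform_matroid E d)) i) = uniform_coeff m d i"
  using assms(2-)
proof (induction d arbitrary: E i rule: less_induct)
  case (less d)
  let ?M = "uniform_matroid E d"
  let ?D = "\<lambda>q. real_of_int (coeff (kl_poly ?M) q) - uniform_coeff m d q"
  have M: "is_matroid ?M" "loopless ?M" using uniform_matroid_loopless less.prems by auto
  have rk: "rk ?M = d"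
    using mrank_uniform_matroid[of E E d] less.prems by (simp add: uniform_matroid_def)
  have IH: "real_of_int (coeff (kl_poly (uniform_matroid (E - F) (d - card F))) i) =
      uniform_coeff m (d - card F) i" if "F \<subseteq> E" "F \<noteq> {}" "card F < d" for F i
  proof (rule less.IH)
    have fF: "finite F" using that less.prems finite_subset by blast
    then have "card F > 0" using that by (simp add: card_gt_0_iff)
    then show "d - card F < d" using that by simp
    show "card (E - F) = m + (d - card F)"
      using that fF less.prems by (simp add: card_Diff_subset)
  qed (use that less.prems in auto)
  have z: "real_of_int (coeff (zpoly ?M) q) = ?D q + uniform_zcoeff m d q" for q
    using less.prems m IH by (intro coeff_zpoly_uniform_matroid) auto
  have "2 * degree (kl_poly ?M) < d"
    using kl_assignment_kl_poly M rk less.prems unfolding kl_assignment_def by auto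
  then have high: "?D q = 0" if "d \<le> 2 * q" for q
    using that by (simp add: uniform_coeff_eq_0 coeff_eq_0)
  have "?D i = 0"
  proof (cases "d \<le> 2 * i")
    case False
    have "coeff (zpoly ?M) i = coeff (zpoly ?M) (d - i)"
      using arg_cong[OF rev_zpoly[OF M], of "\<lambda>p. coeff p i"] False
      by (simp add: rk coeff_rev_poly)
    moreover have "uniform_zcoeff m d i = uniform_zcoeff m d (d - i)"
      using uniform_zcoeff_symmetric[of m i "d - i"] m less.prems False by simp
    ultimately have "?D i = ?D (d - i)" using z[of i] z[of "d - i"] by linarith
    then show ?thesis using high[of "d - i"] False by simp
  qed (rule high)
  then show ?case by simp
qed

section \<open>Passage to the stated form of the coefficients\<close>

text \<open>The sums agree term by term once \<open>h\<close> is shifted by one; each pair of terms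
  is compared through factorials.\<close>

lemma skew_number_eq:
  assumes "2 * i < d"
  shows "skew_number m i (d - i) =
    (\<Sum>h=1..m. (- 1) ^ (h + 1) * real h / real_of_int (int d - int h - int i + int m) *
       int_binomial (int d - int h - int i + int m) (int d - 2 * int i - int h) *
       real ((m + i) choose (m - h)))"
  unfolding skew_number_def sum_divide_distrib sum.atLeast1_atMost_eq[folded One_nat_def]
proof (rule sum.cong)
  define r where "r = d - i"
  fix h assume "h \<in> {..<m}"
  then obtain u where m: "m = Suc (h + u)" using less_iff_Suc_add by auto
  have r: "i < r" "d = r + i" using assms by (simp_all add: r_def)
  have N: "int d - int (Suc h) - int i + int m = int (r + u)" using r by (simp add: m)
  have k: "int d - 2 * int i - int (Suc h) = int r - int (i + Suc h)" using r by simp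
  have mu: "m - 1 - h = u" "m - Suc h = u" by (simp_all add: m)
  have key: "real (r choose (i + Suc h)) * real ((r - 1 + u) choose (r - 1)) / real r =
      int_binomial (int (r + u)) (int r - int (i + Suc h)) * real ((m + i) choose u) / real (r + u)"
  proof (cases "i + Suc h \<le> r")
    case True
    then obtain v where v: "r = i + Suc h + v" using le_Suc_ex by blast
    have 1: "real (r choose (i + Suc h)) = fact r / (fact (i + Suc h) * fact v)"
      by (subst binomial_fact) (simp_all add: v)
    have 2: "real ((r - 1 + u) choose (r - 1)) = fact (r - 1 + u) / (fact (r - 1) * fact u)"
      by (subst binomial_fact) simp_all
    have 3: "real ((m + i) choose u) = fact (m + i) / (fact u * fact (i + Suc h))"
      by (subst binomial_fact) (simp_all add: m add_ac)
    have "int_binomial (int (r + u)) (int r - int (i + Suc h)) = real ((r + u) choose v)"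
      by (simp add: int_binomial_def v binomial_gbinomial)
    also have "\<dots> = fact (r + u) / (fact v * fact (m + i))"
      by (subst binomial_fact) (simp_all add: v m add_ac)
    finally have 4: "int_binomial (int (r + u)) (int r - int (i + Suc h)) = \<dots>" .
    have 5: "fact (r + u) = real (r + u) * fact (r - 1 + u)" "fact r = real r * fact (r - 1)"
      using r by (simp_all add: fact_reduce)
    have 6: "real (r + u) \<noteq> 0" "real r \<noteq> 0" using r by simp_all
    show ?thesis unfolding 1 2 3 4 5 using 6 by (simp add: divide_simps)
  next
    \<comment> \<open>The lower argument of \<open>int_binomial\<close> is negative, so its value is
      0 by convention, and \<open>r choose (i + Suc h)\<close> is 0 as well.\<close>
    case False
    then show ?thesis by (simp add: int_binomial_def binomial_eq_0)
  qed
  have "(- 1) ^ h * real (Suc h) * real (r choose (i + Suc h)) * real ((r - 1 + u) choose (r - 1)) / real r =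
      (- 1) ^ h * real (Suc h) *
        (real (r choose (i + Suc h)) * real ((r - 1 + u) choose (r - 1)) / real r)"
    by (simp add: mult.assoc)
  also have "\<dots> = (- 1) ^ (Suc h + 1) * real (Suc h) / real_of_int (int (r + u)) *
      int_binomial (int (r + u)) (int r - int (i + Suc h)) * real ((m + i) choose u)"
    unfolding key by (simp add: mult.assoc)
  finally show "(- 1) ^ h * real (Suc h) * real ((d - i) choose (i + Suc h)) *
      real ((d - i - 1 + (m - 1 - h)) choose (d - i - 1)) / real (d - i) =
      (- 1) ^ (Suc h + 1) * real (Suc h) / real_of_int (int d - int (Suc h) - int i + int m) *
       int_binomial (int d - int (Suc h) - int i + int m) (int d - 2 * int i - int (Suc h)) *
       real ((m + i) choose (m - Suc h))"
    unfolding N k mu r_def[symmetric] .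
qed simp

theorem theorem1p3:
  fixes E :: "'a set" and m d i :: nat
  assumes "m \<ge> 1" and "d \<ge> 1"
    and "finite E" and "card E = m + d"
    and "i \<le> (d - 1) div 2"
  shows "real_of_int (coeff (kl_poly (uniform_matroid E d)) i) =
    real ((d + m) choose i) *
    (\<Sum>h=1..m. (- 1) ^ (h + 1) * real h / real_of_int (int d - int h - int i + int m) *
       int_binomial (int d - int h - int i + int m) (int d - 2 * int i - int h) *
       real ((m + i) choose (m - h)))"
proof -
  have "2 * i < d" using assms by linarith
  then show ?thesis
    unfolding coeff_kl_poly_uniform_matroid[OF assms(1-4)] uniform_coeff_def
    by (simp only: skew_number_eq add.commute[of m d])
qed

end
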